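(* Let $M$ be a compact $3$-manifold with triangulation $\mathcal{T}$ having $m$ edges. If the solution $l(t)$ of the flow $\dot{l}(t)=-L(l(t))^{T}R(l(t))$ in the space $\mathfrak{M}_l$ of nondegenerate PL-metrics exists for all time $t\ge 0$ and converges as $t\to+\infty$ to a nondegenerate PL-metric $l_\infty\in\mathcal{M}_l^*$, then a discrete Einstein metric exists on $(M,\mathcal{T})$; moreover, $l_\infty$ is itself a discrete Einstein metric.
   Context: Let $\mathcal{T}=\{V,E,F,T\}$ be a triangulation (vertices, edges, faces, tetrahedra) of a compact $3$-manifold $M$, with $m=|E|$. A PL-metric is a map $l:E\to(0,+\infty)$ such that, for every tetrahedron $\{i,j,k,l\}\in T$, its six edge lengths are realized by a Euclidean tetrahedron. It is nondegenerate if, for every tetrahedron, all edge lengths are positive, the Euclidean volume (given by the Cayley–Menger formula in the edge lengths) is positive, i.e. the Cayley–Menger determinant is positive, and the triangle inequalities hold in each face. The set of nondegenerate PL-metrics is denoted $\mathfrak{M}_l$ and is an open subset of $\mathbb{R}^m_{>0}$; a metric is written as a column vector $l=(l_1,\dots,l_m)^T$ after ordering the edges. The combinatorial Ricci curvature at an edge $\{i,j\}$ is $R_{ij}=2\pi-\sum_{\{i,j,k,l\}\in T}\beta_{ij,kl}$, where the sum is over all tetrahedra containing $\{i,j\}$ and $\beta_{ij,kl}$ is the dihedral angle of the Euclidean tetrahedron $\{i,j,k,l\}$ at the edge $\{i,j\}$; write $R=R(l)=(R_1,\dots,R_m)^T$ with the same ordering, and $L=L(l)=\bigl(\partial R_i/\partial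 l_j\bigr)_{1\le i,j\le m}$. Let $\mathcal{M}_l^*=\{l\in\mathfrak{M}_l : \operatorname{rank}L(l)=m-1\}$. A metric $l\in\mathfrak{M}_l$ is a discrete Einstein metric if there is a real number $\lambda$ with $R(l)=\lambda l$. *)

theory Defs
  imports "HOL-Analysis.Analysis"
begin

definition compact_3_manifold :: "'x topology \<Rightarrow> bool" where
  "compact_3_manifold M \<longleftrightarrow>
     compact_space M \<and> Hausdorff_space M \<and> second_countable M \<and>
     (\<forall>x \<in> topspace M. \<exists>U (W :: (real^3) set).
        openin M U \<and> x \<in> U \<and> open W \<and> subtopology M U homeomorphic_space top_of_set W)"

definition triangulates :: "'v::euclidean_space set set \<Rightarrow> 'x topology \<Rightarrow> bool" where
  "triangulates K M \<longleftrightarrow> simplicial_complex K \<and> top_of_set (\<Union>K) homeomorphic_space M"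

text \<open>
  Simplices are handled through their vertex sets, so that edges, faces and tetrahedra are sets of
  the form $\{i,j\}$, $\{i,j,k\}$ and $\{i,j,k,h\}$.  The positions of the vertices in the ambient
  space of \<open>K\<close> play no role for PL-metrics.
\<close>

definition vertex_sets :: "nat \<Rightarrow> 'v::euclidean_space set set \<Rightarrow> 'v set set" where
  "vertex_sets n K = {\<sigma>. \<not> affine_dependent \<sigma> \<and> card \<sigma> = n + 1 \<and> convex hull \<sigma> \<in> K}"

abbreviation edges :: "'v::euclidean_space set set \<Rightarrow> 'v set set" where
  "edges \<equiv> vertex_sets 1"

abbreviation faces :: "'v::euclidean_space set set \<Rightarrow> 'v set set" where
  "faces \<equiv> vertex_sets 2"

abbreviation tetrahedra :: "'v::euclidean_space set set \<Rightarrow> 'v set set" where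
  "tetrahedra \<equiv> vertex_sets 3"

text \<open>
  The possibly degenerate Euclidean tetrahedron with vertices \<open>P a\<close>, \<open>a \<in> \<tau>\<close>, has the edge
  lengths prescribed by \<open>d\<close>.
\<close>

definition realizes :: "('v \<Rightarrow> real^3) \<Rightarrow> ('v set \<Rightarrow> real) \<Rightarrow> 'v set \<Rightarrow> bool" where
  "realizes P d \<tau> \<longleftrightarrow> (\<forall>a\<in>\<tau>. \<forall>b\<in>\<tau>. a \<noteq> b \<longrightarrow> dist (P a) (P b) = d {a, b})"

definition pl_metric :: "'v::euclidean_space set set \<Rightarrow> ('v set \<Rightarrow> real) \<Rightarrow> bool" where
  "pl_metric K d \<longleftrightarrow>
     (\<forall>\<epsilon> \<in> edges K. 0 < d \<epsilon>) \<and> (\<forall>\<tau> \<in> tetrahedra K. \<exists>P. realizes P d \<tau>)"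

text \<open>The Cayley--Menger determinant is $288$ times the squared volume.\<close>

definition cayley_menger :: "('v set \<Rightarrow> real) \<Rightarrow> 'v \<Rightarrow> 'v \<Rightarrow> 'v \<Rightarrow> 'v \<Rightarrow> real" where
  "cayley_menger d i j k h = det (vector
     [vector [0, 1,             1,             1,             1            ],
      vector [1, 0,             (d {i, j})\<^sup>2, (d {i, k})\<^sup>2, (d {i, h})\<^sup>2],
      vector [1, (d {i, j})\<^sup>2, 0,             (d {j, k})\<^sup>2, (d {j, h})\<^sup>2],
      vector [1, (d {i, k})\<^sup>2, (d {j, k})\<^sup>2, 0,             (d {k, h})\<^sup>2],
      vector [1, (d {i, h})\<^sup>2, (d {j, h})\<^sup>2, (d {k, h})\<^sup>2, 0            ]] :: real^5^5)"

definition nondegenerate :: "'v::euclidean_space set set \<Rightarrow> ('v set \<Rightarrow> real) \<Rightarrow> bool" where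
  "nondegenerate K d \<longleftrightarrow>
     (\<forall>i j k h. {i, j, k, h} \<in> tetrahedra K \<longrightarrow> 0 < cayley_menger d i j k h) \<and>
     (\<forall>i j k. {i, j, k} \<in> faces K \<longrightarrow> d {i, j} < d {i, k} + d {k, j})"

text \<open>
  The dihedral angle at the edge \<open>pq\<close> of the tetrahedron \<open>pqrs\<close>: the angle between the components
  of \<open>r - p\<close> and \<open>s - p\<close> orthogonal to \<open>q - p\<close>.
\<close>

definition dihedral :: "real^3 \<Rightarrow> real^3 \<Rightarrow> real^3 \<Rightarrow> real^3 \<Rightarrow> real" where
  "dihedral p q r s =
     (let w = q - p;
          u = (r - p) - (((r - p) \<bullet> w) / (w \<bullet> w)) *\<^sub>R w;
          v = (s - p) - (((s - p) \<bullet> w) / (w \<bullet> w)) *\<^sub>R w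
      in arccos ((u \<bullet> v) / (norm u * norm v)))"

text \<open>
  The angle does not depend on the realization \<open>P\<close>, which is unique up to isometry, nor on the
  labelling of the vertices; so the description is definite for nondegenerate PL-metrics.
\<close>

definition dihedral_angle :: "('v set \<Rightarrow> real) \<Rightarrow> 'v set \<Rightarrow> 'v set \<Rightarrow> real" where
  "dihedral_angle d \<epsilon> \<tau> =
     (THE \<beta>. \<exists>P i j k h. realizes P d \<tau> \<and> \<epsilon> = {i, j} \<and> \<tau> = {i, j, k, h} \<and>
                \<beta> = dihedral (P i) (P j) (P k) (P h))"

definition curvature :: "'v::euclidean_space set set \<Rightarrow> ('v set \<Rightarrow> real) \<Rightarrow> 'v set \<Rightarrow> real" where
  "curvature K d \<epsilon> = 2 * pi - (\<Sum>\<tau> | \<tau> \<in> tetrahedra K \<and> \<epsilon> \<subseteq> \<tau>. dihedral_angle d \<epsilon> \<tau>)"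

text \<open>
  An ordering of the edges is a bijection \<open>e\<close> from the index type \<open>'m\<close> onto the edges.  The vector
  \<open>l :: real^'m\<close> then stands for the length function below, whose values matter only on the edges.
\<close>

definition edge_lengths :: "('m::finite \<Rightarrow> 'v set) \<Rightarrow> real^'m \<Rightarrow> 'v set \<Rightarrow> real" where
  "edge_lengths e l \<epsilon> = l $ inv e \<epsilon>"

definition nondeg_metrics ::
    "'v::euclidean_space set set \<Rightarrow> ('m::finite \<Rightarrow> 'v set) \<Rightarrow> (real^'m) set" where
  "nondeg_metrics K e =
     {l. pl_metric K (edge_lengths e l) \<and> nondegenerate K (edge_lengths e l)}"

definition curvature_vec ::
    "'v::euclidean_space set set \<Rightarrow> ('m::finite \<Rightarrow> 'v set) \<Rightarrow> real^'m \<Rightarrow> real^'m" where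
  "curvature_vec K e l = (\<chi> i. curvature K (edge_lengths e l) (e i))"

definition curvature_jacobian ::
    "'v::euclidean_space set set \<Rightarrow> ('m::finite \<Rightarrow> 'v set) \<Rightarrow> real^'m \<Rightarrow> real^'m^'m" where
  "curvature_jacobian K e l =
     (\<chi> i j. deriv (\<lambda>s. curvature_vec K e (l + s *\<^sub>R axis j 1) $ i) 0)"

definition max_rank_metrics ::
    "'v::euclidean_space set set \<Rightarrow> ('m::finite \<Rightarrow> 'v set) \<Rightarrow> (real^'m) set" where
  "max_rank_metrics K e =
     {l \<in> nondeg_metrics K e. rank (curvature_jacobian K e l) = CARD('m) - 1}"

definition discrete_einstein ::
    "'v::euclidean_space set set \<Rightarrow> ('m::finite \<Rightarrow> 'v set) \<Rightarrow> real^'m \<Rightarrow> bool" where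
  "discrete_einstein K e l \<longleftrightarrow>
     l \<in> nondeg_metrics K e \<and> (\<exists>c::real. curvature_vec K e l = c *\<^sub>R l)"

end

theory Submission
  imports Defs
begin

text \<open>
  Write $R$ for the curvature map and $L$ for its Jacobian, and let $l_\infty$ be the limit of the
  flow.  If the right-hand side of an autonomous differential equation is continuous at the limit of a
  solution, it vanishes there; so $L^T R = 0$ at $l_\infty$.  Two properties of $L$ finish the proof.
  It is symmetric, which is a form of the Schlaefli formula, so that $L R = 0$.  And $R$ is invariant
  under scaling of the lengths, so that $L l = 0$ by Euler's relation.  As $L$ has corank one at
  $l_\infty$ and $l_\infty \neq 0$, the vector $R$ is a multiple of $l_\infty$.

  All the work is to make this rigorous for dihedral angles.  In a tetrahedron with the six edge lengths
  \<open>a b c p q r\<close> the angle at the edge of length \<open>a\<close> is an explicit function \<open>edge_angle\<close>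
  (\<open>dihedral_eq_edge_angle\<close>), so its total derivative \<open>dedge_angle\<close> and the continuity of that
  derivative come from calculus.  The symmetry of $L$ is checked tetrahedron by tetrahedron
  (\<open>schlaefli_form_sym\<close>): the derivative of the angle at one edge by the length of another edge is
  given by one of two closed formulas, according to whether the two edges meet or are opposite, and
  both formulas are symmetric in the two edges.

  The dihedral angle of a length function is defined through realizations by points of space, so
  differentiating it needs realizations for all nearby lengths too.  They exist because being
  the edge lengths of a genuine tetrahedron amounts to strict polynomial inequalities
  (\<open>tetrahedral\<close>): for realized lengths, a nonzero Cayley--Menger determinant forces these inequalities
  (\<open>tetrahedral_of_realization\<close>), they persist under small perturbations
  (\<open>eventually_tetrahedral_at\<close>), and they permit an explicit construction of the vertices
  (\<open>tetrahedral_realizable\<close>).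
\<close>

section \<open>The dihedral angle as a function of the six edge lengths\<close>

text \<open>
  For a tetrahedron with vertices $i,j,k,h$ the six lengths are always listed as
  \<open>a b c p q r\<close> $= ij, ik, ih, jk, jh, kh$.  With $w = j - i$, $x = k - i$, $y = h - i$ the law of
  cosines $2\,w\cdot x = a^2 + b^2 - p^2$ (and its analogues) expresses all inner products by the
  lengths.  In these terms \<open>dihedral_num\<close> is $4(|w|^2\, x\cdot y - (x\cdot w)(y\cdot w))$, the
  quantity \<open>heron\<close> is $16$ times the squared area of the face with sides \<open>a b p\<close>, and
  \<open>gram_det\<close> is four times the Gram determinant of $w, x, y$.
\<close>

definition dihedral_num :: "real \<Rightarrow> real \<Rightarrow> real \<Rightarrow> real \<Rightarrow> real \<Rightarrow> real \<Rightarrow> real" where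
  "dihedral_num a b c p q r = 2 * a\<^sup>2 * (b\<^sup>2 + c\<^sup>2 - r\<^sup>2) - (a\<^sup>2 + b\<^sup>2 - p\<^sup>2) * (a\<^sup>2 + c\<^sup>2 - q\<^sup>2)"

definition heron :: "real \<Rightarrow> real \<Rightarrow> real \<Rightarrow> real" where
  "heron a b p = 4 * a\<^sup>2 * b\<^sup>2 - (a\<^sup>2 + b\<^sup>2 - p\<^sup>2)\<^sup>2"

definition gram_det :: "real \<Rightarrow> real \<Rightarrow> real \<Rightarrow> real \<Rightarrow> real \<Rightarrow> real \<Rightarrow> real" where
  "gram_det a b c p q r = 4 * a\<^sup>2 * b\<^sup>2 * c\<^sup>2
     + (a\<^sup>2 + b\<^sup>2 - p\<^sup>2) * (a\<^sup>2 + c\<^sup>2 - q\<^sup>2) * (b\<^sup>2 + c\<^sup>2 - r\<^sup>2)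
     - a\<^sup>2 * (b\<^sup>2 + c\<^sup>2 - r\<^sup>2)\<^sup>2 - b\<^sup>2 * (a\<^sup>2 + c\<^sup>2 - q\<^sup>2)\<^sup>2 - c\<^sup>2 * (a\<^sup>2 + b\<^sup>2 - p\<^sup>2)\<^sup>2"

text \<open>
  For the components $u, v$ of $x, y$ orthogonal to $w$ this is the identity
  $|u|^2|v|^2 = (u\cdot v)^2 + |u \times v|^2$, up to factors: the two face areas, the cosine and the
  sine of the dihedral angle, and the volume.
\<close>

lemma heron_mult_heron:
  "heron a b p * heron a c q = (dihedral_num a b c p q r)\<^sup>2 + 4 * a\<^sup>2 * gram_det a b c p q r"
  unfolding heron_def dihedral_num_def gram_det_def by algebra

lemma gram_det_perm:
  "gram_det a c b q p r = gram_det a b c p q r"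
  "gram_det b a c p r q = gram_det a b c p q r"
  "gram_det a p q b c r = gram_det a b c p q r"
  unfolding gram_det_def by algebra+

lemma heron_perm: "heron b a p = heron a b p" "heron a p b = heron a b p"
  unfolding heron_def by algebra+

definition edge_angle :: "real \<Rightarrow> real \<Rightarrow> real \<Rightarrow> real \<Rightarrow> real \<Rightarrow> real \<Rightarrow> real" where
  "edge_angle a b c p q r = arccos (dihedral_num a b c p q r / sqrt (heron a b p * heron a c q))"

text \<open>
  As $UW - N^2$ is the square \<open>k\<^sup>2\<close>, the sine of the angle is $k/\sqrt{UW}$, so that $\sqrt{UW}$ cancels
  from the derivative.
\<close>

lemma arccos_quotient_has_derivative:
  fixes N U W :: "'z::real_normed_vector \<Rightarrow> real"
  assumes N: "(N has_derivative N') (at x)" and U: "(U has_derivative U') (at x)"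
    and W: "(W has_derivative W') (at x)"
    and pos: "U x > 0" "W x > 0" "k > 0" and eq: "U x * W x = (N x)\<^sup>2 + k\<^sup>2"
  shows "((\<lambda>z. arccos (N z / sqrt (U z * W z))) has_derivative
     (\<lambda>h. - (N' h - N x * U' h / (2 * U x) - N x * W' h / (2 * W x)) / k)) (at x)"
proof -
  define S where "S = sqrt (U x * W x)"
  have S: "S > 0" "S * S = U x * W x" "S\<^sup>2 = U x * W x" using pos by (auto simp: S_def)
  have UW: "((\<lambda>z. U z * W z) has_derivative (\<lambda>h. U x * W' h + U' h * W x)) (at x)"
    by (rule has_derivative_mult[OF U W])
  have SD: "((\<lambda>z. sqrt (U z * W z)) has_derivative
     (\<lambda>h. (U x * W' h + U' h * W x) * (inverse S / 2))) (at x)"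
    unfolding S_def by (rule has_derivative_real_sqrt[OF _ UW]) (simp add: pos)
  have S0: "sqrt (U x * W x) \<noteq> 0" using S(1) S_def by linarith
  have "((\<lambda>z. N z / sqrt (U z * W z)) has_derivative
     (\<lambda>h. (N' h * S - N x * ((U x * W' h + U' h * W x) * (inverse S / 2))) / (S * S))) (at x)"
    using has_derivative_divide'[OF N SD S0] unfolding S_def .
  moreover have "(N' h * S - N x * ((U x * W' h + U' h * W x) * (inverse S / 2))) / (S * S)
      = (N' h - N x * U' h / (2 * U x) - N x * W' h / (2 * W x)) / S" for h
  proof -
    have "(N' h * S - N x * ((U x * W' h + U' h * W x) * (inverse S / 2))) / (S * S)
      = (N' h - N x * ((U' h * W x + U x * W' h) / (2 * (S * S)))) / S"
      using S(1) by (simp add: field_simps)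
    also have "\<dots> = (N' h - N x * U' h / (2 * U x) - N x * W' h / (2 * W x)) / S"
      unfolding S(2) using pos S(1) by (simp add: field_simps)
    finally show ?thesis .
  qed
  ultimately have Q: "((\<lambda>z. N z / sqrt (U z * W z)) has_derivative
     (\<lambda>h. (N' h - N x * U' h / (2 * U x) - N x * W' h / (2 * W x)) / S)) (at x)"
    by simp
  have "(N x)\<^sup>2 < S\<^sup>2" using eq pos S by simp
  then have lt: "\<bar>N x / S\<bar> < 1"
    using S(1) power2_less_imp_less[of "\<bar>N x\<bar>" S] by (simp add: abs_divide)
  have "1 - (N x / S)\<^sup>2 = (k / S)\<^sup>2"
  proof -
    have "(N x / S)\<^sup>2 + (k / S)\<^sup>2 = ((N x)\<^sup>2 + k\<^sup>2) / S\<^sup>2"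
      by (simp add: power_divide add_divide_distrib)
    also have "\<dots> = 1" using eq S pos by (simp add: sum_power2_eq_zero_iff)
    finally show ?thesis by simp
  qed
  then have k: "sqrt (1 - (N x / S)\<^sup>2) = k / S" using S(1) pos by simp
  have b: "- 1 < N x / sqrt (U x * W x)" "N x / sqrt (U x * W x) < 1"
    using lt unfolding S_def by linarith+
  have "((\<lambda>z. arccos (N z / sqrt (U z * W z))) has_derivative
     (\<lambda>h. ((N' h - N x * U' h / (2 * U x) - N x * W' h / (2 * W x)) / S)
            * inverse (- sqrt (1 - (N x / S)\<^sup>2)))) (at x)"
    using has_derivative_arccos[OF b Q] unfolding S_def .
  moreover have "X / S * inverse (- (k / S)) = - X / k" for X
    using S(1) pos by simp
  ultimately show ?thesis by (simp only: k)
qed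

definition ddihedral_num :: "real \<Rightarrow> real \<Rightarrow> real \<Rightarrow> real \<Rightarrow> real \<Rightarrow> real
    \<Rightarrow> real \<Rightarrow> real \<Rightarrow> real \<Rightarrow> real \<Rightarrow> real \<Rightarrow> real \<Rightarrow> real" where
  "ddihedral_num a b c p q r a' b' c' p' q' r' =
     4 * a * a' * (b\<^sup>2 + c\<^sup>2 - r\<^sup>2) + 4 * a\<^sup>2 * (b * b' + c * c' - r * r')
     - 2 * (a * a' + b * b' - p * p') * (a\<^sup>2 + c\<^sup>2 - q\<^sup>2)
     - 2 * (a\<^sup>2 + b\<^sup>2 - p\<^sup>2) * (a * a' + c * c' - q * q')"

definition dheron :: "real \<Rightarrow> real \<Rightarrow> real \<Rightarrow> real \<Rightarrow> real \<Rightarrow> real \<Rightarrow> real" where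
  "dheron a b p a' b' p' = 8 * a * b\<^sup>2 * a' + 8 * a\<^sup>2 * b * b'
     - 4 * (a\<^sup>2 + b\<^sup>2 - p\<^sup>2) * (a * a' + b * b' - p * p')"

text \<open>
  The primed arguments are the direction of differentiation.  The formula is that of
  \<open>arccos_quotient_has_derivative\<close> with \<open>k = 2 * a * sqrt (gram_det a b c p q r)\<close>, whose square is
  as required by \<open>heron_mult_heron\<close>.
\<close>

definition dedge_angle :: "real \<Rightarrow> real \<Rightarrow> real \<Rightarrow> real \<Rightarrow> real \<Rightarrow> real
    \<Rightarrow> real \<Rightarrow> real \<Rightarrow> real \<Rightarrow> real \<Rightarrow> real \<Rightarrow> real \<Rightarrow> real" where
  "dedge_angle a b c p q r a' b' c' p' q' r' =
     - (ddihedral_num a b c p q r a' b' c' p' q' r'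
        - dihedral_num a b c p q r * dheron a b p a' b' p' / (2 * heron a b p)
        - dihedral_num a b c p q r * dheron a c q a' c' q' / (2 * heron a c q))
     / (2 * a * sqrt (gram_det a b c p q r))"

lemma edge_angle_has_derivative:
  fixes a b c p q r :: "'z::real_normed_vector \<Rightarrow> real"
  assumes D: "(a has_derivative a') (at x)" "(b has_derivative b') (at x)"
    "(c has_derivative c') (at x)" "(p has_derivative p') (at x)"
    "(q has_derivative q') (at x)" "(r has_derivative r') (at x)"
    and pos: "a x > 0" "heron (a x) (b x) (p x) > 0" "heron (a x) (c x) (q x) > 0"
      "gram_det (a x) (b x) (c x) (p x) (q x) (r x) > 0"
  shows "((\<lambda>z. edge_angle (a z) (b z) (c z) (p z) (q z) (r z)) has_derivative
     (\<lambda>h. dedge_angle (a x) (b x) (c x) (p x) (q x) (r x) (a' h) (b' h) (c' h) (p' h) (q' h) (r' h)))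
     (at x)"
  unfolding edge_angle_def dedge_angle_def
proof (rule arccos_quotient_has_derivative)
  show "((\<lambda>z. dihedral_num (a z) (b z) (c z) (p z) (q z) (r z)) has_derivative
     (\<lambda>h. ddihedral_num (a x) (b x) (c x) (p x) (q x) (r x) (a' h) (b' h) (c' h) (p' h) (q' h) (r' h))) (at x)"
    unfolding dihedral_num_def ddihedral_num_def
    by (rule derivative_eq_intros D refl)+ (simp add: fun_eq_iff algebra_simps power2_eq_square)
  show "((\<lambda>z. heron (a z) (b z) (p z)) has_derivative
     (\<lambda>h. dheron (a x) (b x) (p x) (a' h) (b' h) (p' h))) (at x)"
    unfolding heron_def dheron_def
    by (rule derivative_eq_intros D refl)+ (simp add: fun_eq_iff algebra_simps power2_eq_square)
  show "((\<lambda>z. heron (a z) (c z) (q z)) has_derivative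
     (\<lambda>h. dheron (a x) (c x) (q x) (a' h) (c' h) (q' h))) (at x)"
    unfolding heron_def dheron_def
    by (rule derivative_eq_intros D refl)+ (simp add: fun_eq_iff algebra_simps power2_eq_square)
qed (use pos in \<open>auto simp: heron_mult_heron power_mult_distrib\<close>)

section \<open>The symmetric form of a tetrahedron\<close>

text \<open>
  The partial derivative of the angle at an edge by the length of the opposite edge is \<open>opp_coeff\<close>, and
  the one by the length of an adjacent edge, here \<open>b\<close>, is \<open>adj_coeff\<close>; the other three adjacent edges
  arise by relabelling the vertices.
\<close>

definition opp_coeff :: "real \<Rightarrow> real \<Rightarrow> real \<Rightarrow> real \<Rightarrow> real \<Rightarrow> real \<Rightarrow> real" where
  "opp_coeff a b c p q r = 2 * a * r / sqrt (gram_det a b c p q r)"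

definition adj_num :: "real \<Rightarrow> real \<Rightarrow> real \<Rightarrow> real \<Rightarrow> real \<Rightarrow> real \<Rightarrow> real" where
  "adj_num a b c p q r = 8 * a\<^sup>2 * b\<^sup>2 - 4 * b\<^sup>2 * (a\<^sup>2 + c\<^sup>2 - q\<^sup>2) - 2 * (a\<^sup>2 + b\<^sup>2 - p\<^sup>2)\<^sup>2
     - 4 * a\<^sup>2 * (b\<^sup>2 + c\<^sup>2 - r\<^sup>2) + 2 * (a\<^sup>2 + b\<^sup>2 - p\<^sup>2) * (b\<^sup>2 + c\<^sup>2 - r\<^sup>2)
     + 2 * (a\<^sup>2 + b\<^sup>2 - p\<^sup>2) * (a\<^sup>2 + c\<^sup>2 - q\<^sup>2)"

definition adj_coeff :: "real \<Rightarrow> real \<Rightarrow> real \<Rightarrow> real \<Rightarrow> real \<Rightarrow> real \<Rightarrow> real" where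
  "adj_coeff a b c p q r = - a * b * adj_num a b c p q r / (heron a b p * sqrt (gram_det a b c p q r))"

text \<open>
  Exchanging the vertices $j$ and $k$ exchanges the two edges $ij$ and $ik$.
\<close>

lemma adj_coeff_sym: "adj_coeff b a c p r q = adj_coeff a b c p q r"
  by (simp add: adj_coeff_def gram_det_perm heron_perm adj_num_def algebra_simps)

lemma dedge_angle_add:
  "dedge_angle a b c p q r (a1 + a2) (b1 + b2) (c1 + c2) (p1 + p2) (q1 + q2) (r1 + r2) =
   dedge_angle a b c p q r a1 b1 c1 p1 q1 r1 + dedge_angle a b c p q r a2 b2 c2 p2 q2 r2"
  unfolding dedge_angle_def ddihedral_num_def dheron_def
  by (simp add: algebra_simps add_divide_distrib diff_divide_distrib)

text \<open>
  Exchanging $k$ with $h$, or $i$ with $j$, fixes the edge $ij$ and hence must not change its angle or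
  the derivative of its angle.
\<close>

lemma dihedral_num_perm:
  "dihedral_num a c b q p r = dihedral_num a b c p q r"
  "dihedral_num a p q b c r = dihedral_num a b c p q r"
  unfolding dihedral_num_def by algebra+

lemma ddihedral_num_perm:
  "ddihedral_num a c b q p r a' c' b' q' p' r' = ddihedral_num a b c p q r a' b' c' p' q' r'"
  "ddihedral_num a p q b c r a' p' q' b' c' r' = ddihedral_num a b c p q r a' b' c' p' q' r'"
  by (simp_all add: ddihedral_num_def algebra_simps power2_eq_square)

lemma dheron_perm: "dheron a p b a' p' b' = dheron a b p a' b' p'"
  unfolding dheron_def by algebra

lemma dedge_angle_perm:
  "dedge_angle a c b q p r a' c' b' q' p' r' = dedge_angle a b c p q r a' b' c' p' q' r'"
  "dedge_angle a p q b c r a' p' q' b' c' r' = dedge_angle a b c p q r a' b' c' p' q' r'"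
  by (simp_all only: dedge_angle_def dihedral_num_perm ddihedral_num_perm dheron_perm heron_perm gram_det_perm)
     simp_all

definition self_coeff :: "real \<Rightarrow> real \<Rightarrow> real \<Rightarrow> real \<Rightarrow> real \<Rightarrow> real \<Rightarrow> real" where
  "self_coeff a b c p q r = dedge_angle a b c p q r 1 0 0 0 0 0"

lemma dedge_angle_self: "dedge_angle a b c p q r a' 0 0 0 0 0 = self_coeff a b c p q r * a'"
proof -
  have "ddihedral_num a b c p q r a' 0 0 0 0 0 = ddihedral_num a b c p q r 1 0 0 0 0 0 * a'"
    by (simp add: ddihedral_num_def algebra_simps)
  moreover have "dheron a b p a' 0 0 = dheron a b p 1 0 0 * a'" for a b p
    by (simp add: dheron_def algebra_simps)
  ultimately show ?thesis by (simp add: self_coeff_def dedge_angle_def left_diff_distrib)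
qed

text \<open>
  The derivative of \<open>heron a b p\<close> by \<open>b\<close> enters, but the resulting numerator is divisible
  by \<open>a\<^sup>2\<close>; the cofactor \<open>adj_num\<close> is symmetric in the two edges \<open>a\<close> and \<open>b\<close>.
\<close>

lemma dedge_angle_adj:
  assumes "a > 0" "heron a b p > 0" "gram_det a b c p q r > 0"
  shows "dedge_angle a b c p q r 0 b' 0 0 0 0 = adj_coeff a b c p q r * b'"
proof -
  define g where "g = sqrt (gram_det a b c p q r)"
  have g: "g > 0" using assms by (simp add: g_def)
  have z: "dheron a c q 0 0 0 = 0" by (simp add: dheron_def)
  have "2 * heron a b p * ddihedral_num a b c p q r 0 b' 0 0 0 0 - dihedral_num a b c p q r * dheron a b p 0 b' 0
      = 4 * a\<^sup>2 * b * b' * adj_num a b c p q r"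
    unfolding heron_def ddihedral_num_def dihedral_num_def dheron_def adj_num_def by algebra
  then have "ddihedral_num a b c p q r 0 b' 0 0 0 0 - dihedral_num a b c p q r * dheron a b p 0 b' 0 / (2 * heron a b p)
      = 4 * a\<^sup>2 * b * b' * adj_num a b c p q r / (2 * heron a b p)"
    using assms(2) by (simp add: field_simps)
  then show ?thesis using assms g unfolding dedge_angle_def adj_coeff_def g_def[symmetric]
    by (simp add: z divide_simps power2_eq_square)
qed

lemma dedge_angle_opp:
  assumes "a > 0"
  shows "dedge_angle a b c p q r 0 0 0 0 0 r' = opp_coeff a b c p q r * r'"
  using assms by (simp add: dedge_angle_def dheron_def ddihedral_num_def opp_coeff_def field_simps power2_eq_square)

text \<open>
  One face and the Gram determinant suffice: any two faces share an edge, so \<open>heron_mult_heron\<close> carries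
  positivity from one face to the others.
\<close>

definition tetrahedral :: "real \<Rightarrow> real \<Rightarrow> real \<Rightarrow> real \<Rightarrow> real \<Rightarrow> real \<Rightarrow> bool" where
  "tetrahedral a b c p q r \<longleftrightarrow> a > 0 \<and> b > 0 \<and> c > 0 \<and> p > 0 \<and> q > 0 \<and> r > 0 \<and>
     heron a b p > 0 \<and> gram_det a b c p q r > 0"

lemma tetrahedral_faces:
  assumes "tetrahedral a b c p q r"
  shows "heron a c q > 0" "heron b c r > 0" "heron p q r > 0"
proof -
  have pos: "heron a b p * heron a c q > 0" if "a > 0" "gram_det a b c p q r > 0" for a b c p q r
    unfolding heron_mult_heron[of _ _ _ _ _ r] using that by (simp add: add_nonneg_pos)
  show "heron a c q > 0" using pos[of a b c p q r] assms by (auto simp: tetrahedral_def zero_less_mult_iff)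
  show "heron b c r > 0" using pos[of b a c p r q] assms
    by (auto simp: tetrahedral_def zero_less_mult_iff gram_det_perm heron_perm)
  have "gram_det p a q b r c = gram_det a b c p q r" unfolding gram_det_def by algebra
  moreover have "heron p a b = heron a b p" unfolding heron_def by algebra
  ultimately show "heron p q r > 0" using pos[of p a q b r c] assms
    by (auto simp: tetrahedral_def zero_less_mult_iff heron_perm)
qed

lemma tetrahedral_perm:
  assumes "tetrahedral a b c p q r"
  shows "tetrahedral a c b q p r" "tetrahedral b a c p r q" "tetrahedral a p q b c r"
  using assms tetrahedral_faces[OF assms] by (auto simp: tetrahedral_def gram_det_perm heron_perm)

lemma dedge_angle_expand:
  assumes T: "tetrahedral a b c p q r"
  shows "dedge_angle a b c p q r a' b' c' p' q' r' =
     self_coeff a b c p q r * a' + adj_coeff a b c p q r * b' + adj_coeff a c b q p r * c'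
     + adj_coeff a p q b c r * p' + adj_coeff a q p c b r * q' + opp_coeff a b c p q r * r'"
proof -
  have "dedge_angle a b c p q r a' b' c' p' q' r' =
      dedge_angle a b c p q r a' 0 0 0 0 0 + dedge_angle a b c p q r 0 b' 0 0 0 0
     + dedge_angle a b c p q r 0 0 c' 0 0 0 + dedge_angle a b c p q r 0 0 0 p' 0 0
     + dedge_angle a b c p q r 0 0 0 0 q' 0 + dedge_angle a b c p q r 0 0 0 0 0 r'"
    by (simp add: dedge_angle_add[symmetric])
  moreover have "dedge_angle a b c p q r 0 b' 0 0 0 0 = adj_coeff a b c p q r * b'"
    using T by (intro dedge_angle_adj) (auto simp: tetrahedral_def)
  moreover have "dedge_angle a b c p q r 0 0 c' 0 0 0 = adj_coeff a c b q p r * c'"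
    using tetrahedral_perm(1)[OF T] dedge_angle_perm(1)[of a b c p q r 0 0 c' 0 0 0]
    by (simp add: tetrahedral_def dedge_angle_adj)
  moreover have "dedge_angle a b c p q r 0 0 0 p' 0 0 = adj_coeff a p q b c r * p'"
    using tetrahedral_perm(3)[OF T] dedge_angle_perm(2)[of a b c p q r 0 0 0 p' 0 0]
    by (simp add: tetrahedral_def dedge_angle_adj)
  moreover have "dedge_angle a b c p q r 0 0 0 0 q' 0 = adj_coeff a q p c b r * q'"
    using tetrahedral_perm(1)[OF tetrahedral_perm(3)[OF T]] dedge_angle_perm(2)[of a b c p q r 0 0 0 0 q' 0]
      dedge_angle_perm(1)[of a p q b c r 0 0 q' 0 0 0]
    by (simp add: tetrahedral_def dedge_angle_adj)
  moreover have "dedge_angle a b c p q r 0 0 0 0 0 r' = opp_coeff a b c p q r * r'"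
    using T by (intro dedge_angle_opp) (auto simp: tetrahedral_def)
  ultimately show ?thesis using dedge_angle_self[of a b c p q r a'] by simp
qed

text \<open>
  Exchanging $i$ with $k$ and $j$ with $h$ exchanges the opposite edges $ij$ and $kh$.
\<close>

lemma opp_coeff_sym: "opp_coeff r b p c q a = opp_coeff a b c p q r"
proof -
  have "gram_det r b p c q a = gram_det a b c p q r" unfolding gram_det_def by algebra
  then show ?thesis by (simp add: opp_coeff_def)
qed

text \<open>
  The directional derivatives in direction \<open>h\<close> of the six angles, paired with a second direction \<open>v\<close>.
  Its symmetry says that the one-form $\sum \beta\, dl$ on the space of edge lengths is closed.  Each
  summand lists the lengths for a relabelling of the vertices that puts its own edge first.
\<close>

definition schlaefli_form where
  "schlaefli_form a b c p q r va vb vc vp vq vr ha hb hc hp hq hr =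
     va * dedge_angle a b c p q r ha hb hc hp hq hr
   + vb * dedge_angle b a c p r q hb ha hc hp hr hq
   + vc * dedge_angle c a b q r p hc ha hb hq hr hp
   + vp * dedge_angle p a q b r c hp ha hq hb hr hc
   + vq * dedge_angle q a p c r b hq ha hp hc hr hb
   + vr * dedge_angle r b p c q a hr hb hp hc hq (ha::real)"

text \<open>
  Expanding all six derivatives gives a $6\times 6$ matrix whose off-diagonal entries are the
  coefficients for adjacent and opposite edges, and these are symmetric.
\<close>

lemma schlaefli_form_sym:
  assumes T: "tetrahedral a b c p q r"
  shows "schlaefli_form a b c p q r va vb vc vp vq vr ha hb hc hp hq hr =
    schlaefli_form a b c p q r ha hb hc hp hq hr va vb vc vp vq vr"
proof -
  note perm = tetrahedral_perm
  have Tb: "tetrahedral b a c p r q" using perm(2)[OF T] .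
  have Tc: "tetrahedral c a b q r p" using perm(2)[OF perm(1)[OF T]] .
  have Tp: "tetrahedral p a q b r c" using perm(2)[OF perm(3)[OF T]] .
  have Tq: "tetrahedral q a p c r b" using perm(2)[OF perm(1)[OF perm(3)[OF T]]] .
  have Tr: "tetrahedral r b p c q a" using perm(2)[OF perm(1)[OF perm(3)[OF Tb]]] .
  show ?thesis
    unfolding schlaefli_form_def dedge_angle_expand[OF T] dedge_angle_expand[OF Tb]
      dedge_angle_expand[OF Tc] dedge_angle_expand[OF Tp] dedge_angle_expand[OF Tq]
      dedge_angle_expand[OF Tr]
    unfolding adj_coeff_sym[of a b] adj_coeff_sym[of a c] adj_coeff_sym[of a p] adj_coeff_sym[of a q]
      adj_coeff_sym[of b c] adj_coeff_sym[of b p] adj_coeff_sym[of b r]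
      adj_coeff_sym[of c q] adj_coeff_sym[of c r]
      adj_coeff_sym[of p q] adj_coeff_sym[of p r] adj_coeff_sym[of q r]
      opp_coeff_sym[of a] opp_coeff_sym[of b] opp_coeff_sym[of c]
    by (simp add: algebra_simps)
qed

text \<open>
  Euler's relation for the angle, which is homogeneous of degree $0$: the quotient under the arc
  cosine has a numerator and a denominator that are homogeneous of degree $4$.
\<close>

lemma dedge_angle_euler:
  assumes "tetrahedral a b c p q r"
  shows "dedge_angle a b c p q r a b c p q r = 0"
proof -
  have "ddihedral_num a b c p q r a b c p q r = 4 * dihedral_num a b c p q r"
    unfolding ddihedral_num_def dihedral_num_def by algebra
  moreover have "dheron a b p a b p = 4 * heron a b p" for a b p
    unfolding dheron_def heron_def by algebra
  ultimately show ?thesis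
    using assms tetrahedral_faces[OF assms] by (simp add: dedge_angle_def tetrahedral_def)
qed

section \<open>Tetrahedra in space and their edge lengths\<close>

lemma edge_angle_perm:
  "edge_angle a c b q p r = edge_angle a b c p q r"
  "edge_angle a p q b c r = edge_angle a b c p q r"
  by (simp_all add: edge_angle_def dihedral_num_perm heron_perm mult.commute)

lemma orthogonal_components_inner:
  fixes w x y :: "'a::real_inner"
  assumes "w \<noteq> 0"
  defines "u \<equiv> x - ((x \<bullet> w) / (w \<bullet> w)) *\<^sub>R w" and "v \<equiv> y - ((y \<bullet> w) / (w \<bullet> w)) *\<^sub>R w"
  shows "u \<bullet> u = heron (norm w) (norm x) (norm (w - x)) / (4 * (norm w)\<^sup>2)"
    and "u \<bullet> v = dihedral_num (norm w) (norm x) (norm y) (norm (w - x)) (norm (w - y)) (norm (x - y))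
      / (4 * (norm w)\<^sup>2)"
proof -
  have ww: "w \<bullet> w > 0" using assms by simp
  show "u \<bullet> u = heron (norm w) (norm x) (norm (w - x)) / (4 * (norm w)\<^sup>2)"
    unfolding heron_def power2_norm_eq_inner u_def using ww
    by (simp add: inner_diff inner_commute[of w x] divide_simps) (simp add: algebra_simps power2_eq_square)
  show "u \<bullet> v = dihedral_num (norm w) (norm x) (norm y) (norm (w - x)) (norm (w - y)) (norm (x - y))
      / (4 * (norm w)\<^sup>2)"
    unfolding dihedral_num_def power2_norm_eq_inner u_def v_def using ww
    by (simp add: inner_diff inner_commute[of w x] inner_commute[of w y] inner_commute[of y x] divide_simps)
qed

lemma dihedral_eq_edge_angle:
  assumes "A \<noteq> B"
  shows "dihedral A B C D = edge_angle (dist A B) (dist A C) (dist A D) (dist B C) (dist B D) (dist C D)"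
proof -
  define w x y where "w = B - A" and "x = C - A" and "y = D - A"
  define u v where "u = x - ((x \<bullet> w) / (w \<bullet> w)) *\<^sub>R w" and "v = y - ((y \<bullet> w) / (w \<bullet> w)) *\<^sub>R w"
  have w: "w \<noteq> 0" using assms by (simp add: w_def)
  have d: "dist A B = norm w" "dist A C = norm x" "dist A D = norm y"
    "dist B C = norm (w - x)" "dist B D = norm (w - y)" "dist C D = norm (x - y)"
    by (simp_all add: w_def x_def y_def dist_norm norm_minus_commute)
  let ?h = "4 * (norm w)\<^sup>2"
  have n: "norm u * norm v = sqrt (heron (norm w) (norm x) (norm (w - x)) * heron (norm w) (norm y) (norm (w - y))) / ?h"
  proof -
    have "u \<bullet> u = heron (norm w) (norm x) (norm (w - x)) / ?h"
      "v \<bullet> v = heron (norm w) (norm y) (norm (w - y)) / ?h"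
      unfolding u_def v_def by (rule orthogonal_components_inner(1)[OF w])+
    then have "norm u * norm v = sqrt (heron (norm w) (norm x) (norm (w - x)) / ?h
        * (heron (norm w) (norm y) (norm (w - y)) / ?h))"
      by (simp only: norm_eq_sqrt_inner[of u] norm_eq_sqrt_inner[of v] real_sqrt_mult)
    also have "\<dots> = sqrt (heron (norm w) (norm x) (norm (w - x)) * heron (norm w) (norm y) (norm (w - y))) / sqrt (?h\<^sup>2)"
      by (simp add: real_sqrt_divide[symmetric] power2_eq_square)
    finally show ?thesis by (simp only: real_sqrt_abs) simp
  qed
  have "dihedral A B C D = arccos ((u \<bullet> v) / (norm u * norm v))"
    unfolding dihedral_def Let_def w_def[symmetric] x_def[symmetric] y_def[symmetric]
      u_def[symmetric] v_def[symmetric] ..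
  also have "\<dots> = edge_angle (norm w) (norm x) (norm y) (norm (w - x)) (norm (w - y)) (norm (x - y))"
    unfolding n edge_angle_def unfolding u_def v_def orthogonal_components_inner(2)[OF w]
    using w by simp
  finally show ?thesis by (simp add: d)
qed

definition distinct4 :: "'a \<Rightarrow> 'a \<Rightarrow> 'a \<Rightarrow> 'a \<Rightarrow> bool" where "distinct4 i j k h \<longleftrightarrow> card {i,j,k,h} = 4"

lemma distinct4_iff: "distinct4 i j k h \<longleftrightarrow> i \<noteq> j \<and> i \<noteq> k \<and> i \<noteq> h \<and> j \<noteq> k \<and> j \<noteq> h \<and> k \<noteq> h"
  by (auto simp: distinct4_def card_insert_if)

text \<open>
  The description in \<open>dihedral_angle\<close> is definite: the lengths determine the angle, and two
  labellings of the tetrahedron with the same edge $ij$ differ by the exchanges of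
  \<open>edge_angle_perm\<close>.
\<close>

lemma dihedral_angle_eq:
  assumes P: "realizes P d {i, j, k, h}" and c: "card {i, j, k, h} = 4" and pos: "d {i, j} > 0"
  shows "dihedral_angle d {i, j} {i, j, k, h} =
    edge_angle (d {i, j}) (d {i, k}) (d {i, h}) (d {j, k}) (d {j, h}) (d {k, h})"
proof -
  have gen: "dihedral (Q a) (Q b) (Q m) (Q n) =
      edge_angle (d {a, b}) (d {a, m}) (d {a, n}) (d {b, m}) (d {b, n}) (d {m, n})"
    if "realizes Q d {a, b, m, n}" "card {a, b, m, n} = 4" "d {a, b} > 0" for Q a b m n
  proof -
    have "distinct4 a b m n" using that(2) by (simp add: distinct4_def)
    then have r: "dist (Q a) (Q b) = d {a, b}" "dist (Q a) (Q m) = d {a, m}" "dist (Q a) (Q n) = d {a, n}"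
      "dist (Q b) (Q m) = d {b, m}" "dist (Q b) (Q n) = d {b, n}" "dist (Q m) (Q n) = d {m, n}"
      using that(1) by (auto simp: realizes_def distinct4_iff)
    with that(3) have "Q a \<noteq> Q b" by auto
    from dihedral_eq_edge_angle[OF this, of "Q m" "Q n"] show ?thesis unfolding r .
  qed
  show ?thesis
    unfolding dihedral_angle_def
  proof (rule the_equality)
    show "\<exists>Q a b m n. realizes Q d {i, j, k, h} \<and> {i, j} = {a, b} \<and> {i, j, k, h} = {a, b, m, n} \<and>
      edge_angle (d {i, j}) (d {i, k}) (d {i, h}) (d {j, k}) (d {j, h}) (d {k, h})
        = dihedral (Q a) (Q b) (Q m) (Q n)"
      using gen[OF P c pos] P by metis
  next
    fix \<beta> assume "\<exists>Q a b m n. realizes Q d {i, j, k, h} \<and> {i, j} = {a, b} \<and> {i, j, k, h} = {a, b, m, n} \<and>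
      \<beta> = dihedral (Q a) (Q b) (Q m) (Q n)"
    then obtain Q a b m n where Q: "realizes Q d {a, b, m, n}" and e: "{i, j} = {a, b}"
      and t: "{i, j, k, h} = {a, b, m, n}" and \<beta>: "\<beta> = dihedral (Q a) (Q b) (Q m) (Q n)"
      by metis
    have c': "card {a, b, m, n} = 4" using c t by simp
    have D: "distinct4 i j k h" "distinct4 a b m n" using c c' by (simp_all add: distinct4_def)
    have "{i, j, k, h} - {i, j} = {k, h}" "{a, b, m, n} - {a, b} = {m, n}"
      using D by (auto simp: distinct4_iff)
    then have e': "{k, h} = {m, n}" using e t by metis
    have "\<beta> = edge_angle (d {a, b}) (d {a, m}) (d {a, n}) (d {b, m}) (d {b, n}) (d {m, n})"
      using gen[OF Q c'] pos e \<beta> by metis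
    with e e' show "\<beta> = edge_angle (d {i, j}) (d {i, k}) (d {i, h}) (d {j, k}) (d {j, h}) (d {k, h})"
      by (auto simp: doubleton_eq_iff edge_angle_perm insert_commute)
  qed
qed

lemma exhaust_5: "x = 1 \<or> x = 2 \<or> x = 3 \<or> x = 4 \<or> x = 5" for x :: 5
proof (induct x)
  case (of_int z)
  then have "z = 0 \<or> z = 1 \<or> z = 2 \<or> z = 3 \<or> z = 4" by fastforce
  then show ?case by auto
qed

lemma sum_5: "sum f (UNIV::5 set) = f 1 + f 2 + f 3 + f 4 + f 5"
proof -
  have U: "(UNIV::5 set) = {1, 2, 3, 4, 5}" using exhaust_5 by auto
  show ?thesis unfolding U by (simp add: ac_simps)
qed

lemma vector_5:
  "(vector [v, w, x, y, z] :: ('a::zero)^5) $ 1 = v"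
  "(vector [v, w, x, y, z] :: ('a::zero)^5) $ 2 = w"
  "(vector [v, w, x, y, z] :: ('a::zero)^5) $ 3 = x"
  "(vector [v, w, x, y, z] :: ('a::zero)^5) $ 4 = y"
  "(vector [v, w, x, y, z] :: ('a::zero)^5) $ 5 = z"
  unfolding vector_def by simp_all

text \<open>
  An affine dependence $\sum \lambda_a P_a = 0$, $\sum \lambda_a = 0$ makes the function
  $X \mapsto \sum \lambda_a |X - P_a|^2$ constant, with value $\sum \lambda_a |P_a|^2$.  Evaluating it at
  the four vertices shows that the vector of the $\lambda_a$, preceded by minus that constant, lies in the
  kernel of the Cayley--Menger matrix.
\<close>

lemma cayley_menger_eq_0:
  assumes P: "realizes P d {i, j, k, h}" and c: "card {i, j, k, h} = 4"
    and s: "li + lj + lk + lh = 0"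
    and lin: "li *\<^sub>R P i + lj *\<^sub>R P j + lk *\<^sub>R P k + lh *\<^sub>R P h = 0"
    and nz: "li \<noteq> 0 \<or> lj \<noteq> 0 \<or> lk \<noteq> 0 \<or> lh \<noteq> 0"
  shows "cayley_menger d i j k h = 0"
proof -
  have D: "distinct4 i j k h" using c by (simp add: distinct4_def)
  have dd: "(dist X Y)\<^sup>2 = X \<bullet> X - 2 * (X \<bullet> Y) + Y \<bullet> Y" for X Y :: "real^3"
    by (simp add: dist_norm power2_norm_eq_inner inner_diff inner_commute)
  \<comment> \<open>minus the constant value of the weighted sum of squared distances\<close>
  define z0 where "z0 = - (li * (P i \<bullet> P i) + lj * (P j \<bullet> P j) + lk * (P k \<bullet> P k) + lh * (P h \<bullet> P h))"
  have key: "z0 + li * (dist X (P i))\<^sup>2 + lj * (dist X (P j))\<^sup>2 + lk * (dist X (P k))\<^sup>2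
      + lh * (dist X (P h))\<^sup>2 = 0" for X
  proof -
    have "z0 + li * (dist X (P i))\<^sup>2 + lj * (dist X (P j))\<^sup>2 + lk * (dist X (P k))\<^sup>2
      + lh * (dist X (P h))\<^sup>2 = (li + lj + lk + lh) * (X \<bullet> X)
       - 2 * (X \<bullet> (li *\<^sub>R P i + lj *\<^sub>R P j + lk *\<^sub>R P k + lh *\<^sub>R P h))"
      unfolding dd z0_def by (simp add: inner_add_right algebra_simps)
    then show ?thesis using s lin by simp
  qed
  have r: "(d {i, j}) = dist (P i) (P j)" "(d {i, k}) = dist (P i) (P k)" "(d {i, h}) = dist (P i) (P h)"
      "(d {j, k}) = dist (P j) (P k)" "(d {j, h}) = dist (P j) (P h)" "(d {k, h}) = dist (P k) (P h)"
    using P D by (auto simp: realizes_def distinct4_iff)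
  let ?M = "vector
     [vector [0, 1,             1,             1,             1            ],
      vector [1, 0,             (d {i, j})\<^sup>2, (d {i, k})\<^sup>2, (d {i, h})\<^sup>2],
      vector [1, (d {i, j})\<^sup>2, 0,             (d {j, k})\<^sup>2, (d {j, h})\<^sup>2],
      vector [1, (d {i, k})\<^sup>2, (d {j, k})\<^sup>2, 0,             (d {k, h})\<^sup>2],
      vector [1, (d {i, h})\<^sup>2, (d {j, h})\<^sup>2, (d {k, h})\<^sup>2, 0            ]] :: real^5^5"
  let ?z = "vector [z0, li, lj, lk, lh] :: real^5"
  have "(?M *v ?z) $ x = 0 $ x" for x
    using exhaust_5[of x] s key[of "P i"] key[of "P j"] key[of "P k"] key[of "P h"]
    by (auto simp: matrix_vector_mult_def sum_5 vector_5 r dist_commute algebra_simps)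
  then have "?M *v ?z = 0" by (simp add: vec_eq_iff)
  moreover have "?z \<noteq> 0"
  proof
    assume "?z = 0"
    then have "?z $ 2 = 0" "?z $ 3 = 0" "?z $ 4 = 0" "?z $ 5 = 0" by simp_all
    then show False using nz by (simp add: vector_5)
  qed
  ultimately have "rank ?M \<noteq> CARD(5)" using matrix_nonfull_linear_equations_eq by blast
  then have "det ?M = 0" using det_eq_0_rank[of ?M] rank_bound[of ?M] by auto
  then show ?thesis by (simp add: cayley_menger_def)
qed

text \<open>
  By \<open>cayley_menger_eq_0\<close> the edge vectors at a vertex are linearly independent.  Hence the component
  $u$ of $x$ orthogonal to $w$ is nonzero, which gives the area, and so is the combination $z$ of the
  two orthogonal components with $|z|^2 = $ \<open>heron\<close> $\cdot$ \<open>gram_det\<close>, which gives the volume.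
\<close>

lemma tetrahedral_of_realization:
  assumes P: "realizes P d {i, j, k, h}" and c: "card {i, j, k, h} = 4"
    and cm: "cayley_menger d i j k h \<noteq> 0"
    and pos: "d {i, j} > 0" "d {i, k} > 0" "d {i, h} > 0" "d {j, k} > 0" "d {j, h} > 0" "d {k, h} > 0"
  shows "tetrahedral (d {i, j}) (d {i, k}) (d {i, h}) (d {j, k}) (d {j, h}) (d {k, h})"
proof -
  have D: "distinct4 i j k h" using c by (simp add: distinct4_def)
  have r: "(d {i, j}) = dist (P i) (P j)" "(d {i, k}) = dist (P i) (P k)" "(d {i, h}) = dist (P i) (P h)"
      "(d {j, k}) = dist (P j) (P k)" "(d {j, h}) = dist (P j) (P h)" "(d {k, h}) = dist (P k) (P h)"
    using P D by (auto simp: realizes_def distinct4_iff)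
  define w x y where "w = P j - P i" and "x = P k - P i" and "y = P h - P i"
  have d: "d {i, j} = norm w" "d {i, k} = norm x" "d {i, h} = norm y"
    "d {j, k} = norm (w - x)" "d {j, h} = norm (w - y)" "d {k, h} = norm (x - y)"
    by (simp_all add: w_def x_def y_def r dist_norm norm_minus_commute)
  have w: "w \<noteq> 0" using pos d by auto
  have indep: "\<alpha> = 0 \<and> \<beta> = 0 \<and> \<gamma> = 0" if "\<alpha> *\<^sub>R w + \<beta> *\<^sub>R x + \<gamma> *\<^sub>R y = 0" for \<alpha> \<beta> \<gamma>
  proof -
    have "(- \<alpha> - \<beta> - \<gamma>) *\<^sub>R P i + \<alpha> *\<^sub>R P j + \<beta> *\<^sub>R P k + \<gamma> *\<^sub>R P h = 0"
      using that by (simp add: w_def x_def y_def algebra_simps)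
    from cayley_menger_eq_0[OF P c _ this] cm show ?thesis by auto
  qed
  define u v where "u = x - ((x \<bullet> w) / (w \<bullet> w)) *\<^sub>R w" and "v = y - ((y \<bullet> w) / (w \<bullet> w)) *\<^sub>R w"
  let ?U = "heron (norm w) (norm x) (norm (w - x))" and ?W = "heron (norm w) (norm y) (norm (w - y))"
  let ?N = "dihedral_num (norm w) (norm x) (norm y) (norm (w - x)) (norm (w - y)) (norm (x - y))"
  let ?G = "gram_det (norm w) (norm x) (norm y) (norm (w - x)) (norm (w - y)) (norm (x - y))"
  let ?h = "4 * (norm w)\<^sup>2"
  have uu: "u \<bullet> u = ?U / ?h" and vv: "v \<bullet> v = ?W / ?h" and uv: "u \<bullet> v = ?N / ?h"
    unfolding u_def v_def using orthogonal_components_inner[OF w] by blast+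
  have h: "?h > 0" using w by simp
  have "u \<noteq> 0"
    using indep[of "- ((x \<bullet> w) / (w \<bullet> w))" 1 0] by (auto simp: u_def)
  then have "u \<bullet> u > 0" by simp
  then have U: "?U > 0" using uu h by (simp add: zero_less_divide_iff)
  have quot: "U\<^sup>2 * (W / H) - 2 * U * N * (N / H) + N\<^sup>2 * (U / H) = U * (U * W - N\<^sup>2) / H"
    for U W N H :: real
    by (simp add: power2_eq_square diff_divide_distrib right_diff_distrib mult_ac)
  \<comment> \<open>a multiple of the component of \<open>v\<close> orthogonal to \<open>u\<close>\<close>
  define z where "z = ?U *\<^sub>R v - ?N *\<^sub>R u"
  have "z = (?N * ((x \<bullet> w) / (w \<bullet> w)) - ?U * ((y \<bullet> w) / (w \<bullet> w))) *\<^sub>R w + (- ?N) *\<^sub>R x + ?U *\<^sub>R y"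
    by (simp add: z_def u_def v_def algebra_simps)
  then have "z \<noteq> 0" using indep U by (metis less_irrefl)
  then have "z \<bullet> z > 0" by simp
  also have "z \<bullet> z = ?U\<^sup>2 * (v \<bullet> v) - 2 * ?U * ?N * (u \<bullet> v) + ?N\<^sup>2 * (u \<bullet> u)"
    by (simp add: z_def inner_diff_left inner_diff_right inner_commute[of v u] power2_eq_square algebra_simps)
  also have "\<dots> = ?U * (?U * ?W - ?N\<^sup>2) / ?h"
    unfolding uu vv uv by (rule quot)
  also have "\<dots> = ?U * ?G"
    using h unfolding heron_mult_heron[of _ _ _ _ _ "norm (x - y)"] by simp
  finally have "?G > 0" using U by (simp add: zero_less_mult_iff)
  then show ?thesis using pos U unfolding tetrahedral_def d by simp
qed

text \<open>
  The first edge is put on the first axis and the first face into the plane of the first two axes; the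
  remaining coordinates are then forced up to sign.
\<close>

lemma tetrahedral_realizable:
  assumes T: "tetrahedral a b c p q r"
  shows "\<exists>A B C D :: real^3. dist A B = a \<and> dist A C = b \<and> dist A D = c \<and>
    dist B C = p \<and> dist B D = q \<and> dist C D = r"
proof -
  define U W N G where "U = heron a b p" and "W = heron a c q" and "N = dihedral_num a b c p q r"
    and "G = gram_det a b c p q r"
  have pos: "a > 0" "b > 0" "c > 0" "p > 0" "q > 0" "r > 0" "U > 0" "G > 0"
    using T by (auto simp: tetrahedral_def U_def G_def)
  define g where "g = sqrt U"
  have g: "g > 0" "g\<^sup>2 = U" using pos by (auto simp: g_def)
  have UW: "U * W = N\<^sup>2 + 4 * a\<^sup>2 * G" unfolding U_def W_def N_def G_def by (rule heron_mult_heron)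
  define x1 y1 x2 y2 y3 where "x1 = (a\<^sup>2 + b\<^sup>2 - p\<^sup>2) / (2 * a)" and "y1 = (a\<^sup>2 + c\<^sup>2 - q\<^sup>2) / (2 * a)"
    and "x2 = g / (2 * a)" and "y2 = N / (2 * a * g)" and "y3 = sqrt (G / U)"
  have x1: "2 * a * x1 = a\<^sup>2 + b\<^sup>2 - p\<^sup>2" and y1: "2 * a * y1 = a\<^sup>2 + c\<^sup>2 - q\<^sup>2"
    using pos by (simp_all add: x1_def y1_def)
  have bb: "x1\<^sup>2 + x2\<^sup>2 = b\<^sup>2"
  proof -
    have "x1\<^sup>2 + x2\<^sup>2 = ((a\<^sup>2 + b\<^sup>2 - p\<^sup>2)\<^sup>2 + U) / (2 * a)\<^sup>2"
      by (simp add: x1_def x2_def power_divide g add_divide_distrib)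
    also have "(a\<^sup>2 + b\<^sup>2 - p\<^sup>2)\<^sup>2 + U = (2 * a)\<^sup>2 * b\<^sup>2"
      by (simp add: U_def heron_def power_mult_distrib)
    finally show ?thesis using pos by simp
  qed
  have cc: "y1\<^sup>2 + y2\<^sup>2 + y3\<^sup>2 = c\<^sup>2"
  proof -
    have "y2\<^sup>2 + y3\<^sup>2 = N\<^sup>2 / ((2 * a)\<^sup>2 * U) + G / U"
      using pos by (simp add: y2_def y3_def power_divide power_mult_distrib g)
    also have "\<dots> = (U * W) / ((2 * a)\<^sup>2 * U)"
      unfolding UW using pos by (simp add: field_simps)
    also have "\<dots> = W / (2 * a)\<^sup>2" using pos by simp
    finally have "y1\<^sup>2 + y2\<^sup>2 + y3\<^sup>2 = ((a\<^sup>2 + c\<^sup>2 - q\<^sup>2)\<^sup>2 + W) / (2 * a)\<^sup>2"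
      by (simp add: y1_def power_divide add_divide_distrib)
    also have "(a\<^sup>2 + c\<^sup>2 - q\<^sup>2)\<^sup>2 + W = (2 * a)\<^sup>2 * c\<^sup>2"
      by (simp add: W_def heron_def power_mult_distrib)
    finally show ?thesis using pos by simp
  qed
  have bc: "2 * (x1 * y1 + x2 * y2) = b\<^sup>2 + c\<^sup>2 - r\<^sup>2"
  proof -
    have "x2 * y2 = N / (2 * a)\<^sup>2" using g pos by (simp add: x2_def y2_def power2_eq_square)
    then have "x1 * y1 + x2 * y2 = ((a\<^sup>2 + b\<^sup>2 - p\<^sup>2) * (a\<^sup>2 + c\<^sup>2 - q\<^sup>2) + N) / (2 * a)\<^sup>2"
      by (simp add: x1_def y1_def add_divide_distrib power2_eq_square)
    also have "\<dots> = 2 * a\<^sup>2 * (b\<^sup>2 + c\<^sup>2 - r\<^sup>2) / (2 * a)\<^sup>2"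
      by (simp add: N_def dihedral_num_def)
    finally show ?thesis using pos by (simp add: power_mult_distrib)
  qed
  have dI: "dist X Y = t" if "t > 0" "(X$1 - Y$1)\<^sup>2 + (X$2 - Y$2)\<^sup>2 + (X$3 - Y$3)\<^sup>2 = t\<^sup>2"
    for X Y :: "real^3" and t
    using that by (simp add: dist_vec_def L2_set_def sum_3 dist_real_def)
  let ?A = "vector [0, 0, 0] :: real^3" and ?B = "vector [a, 0, 0] :: real^3"
  let ?C = "vector [x1, x2, 0] :: real^3" and ?D = "vector [y1, y2, y3] :: real^3"
  have "dist ?A ?B = a" by (rule dI) (use pos in auto)
  moreover have "dist ?A ?C = b" by (rule dI) (use pos bb in auto)
  moreover have "dist ?A ?D = c" by (rule dI) (use pos cc in auto)
  moreover have "dist ?B ?C = p"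
    by (rule dI) (use pos bb x1 in \<open>auto simp: power2_diff\<close>)
  moreover have "dist ?B ?D = q"
    by (rule dI) (use pos cc y1 in \<open>auto simp: power2_diff\<close>)
  moreover have "dist ?C ?D = r"
    by (rule dI) (use pos bb cc bc in \<open>auto simp: power2_diff algebra_simps\<close>)
  ultimately show ?thesis by blast
qed

lemma realizes_exists:
  assumes "card {i, j, k, h} = 4"
    and "tetrahedral (d {i, j}) (d {i, k}) (d {i, h}) (d {j, k}) (d {j, h}) (d {k, h})"
  shows "\<exists>P. realizes P d {i, j, k, h}"
proof -
  have D: "distinct4 i j k h" using assms(1) by (simp add: distinct4_def)
  from tetrahedral_realizable[OF assms(2)] obtain A B C E :: "real^3" where
    *: "dist A B = d {i, j}" "dist A C = d {i, k}" "dist A E = d {i, h}"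
    "dist B C = d {j, k}" "dist B E = d {j, h}" "dist C E = d {k, h}" by metis
  have "realizes (\<lambda>x. if x = i then A else if x = j then B else if x = k then C else E) d {i, j, k, h}"
    using D by (auto simp: realizes_def distinct4_iff * insert_commute)
      (auto simp: dist_commute * insert_commute)
  then show ?thesis by blast
qed

section \<open>Angles and their derivatives in a triangulation\<close>

lemma edge_of_tetrahedron:
  assumes K: "simplicial_complex K" and t: "\<tau> \<in> tetrahedra K" and "a \<in> \<tau>" "b \<in> \<tau>" "a \<noteq> b"
  shows "{a, b} \<in> edges K"
proof -
  have ind: "\<not> affine_dependent \<tau>" and t: "convex hull \<tau> \<in> K" using t by (auto simp: vertex_sets_def)
  have "\<exists>c\<subseteq>\<tau>. convex hull {a, b} = convex hull c"
    using assms by (intro exI[of _ "{a, b}"]) simp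
  then have "convex hull {a, b} face_of convex hull \<tau>"
    using face_of_convex_hull_affine_independent[OF ind] by blast
  then have "convex hull {a, b} \<in> K" using K t unfolding simplicial_complex_def by blast
  then show ?thesis using assms by (simp add: vertex_sets_def)
qed

text \<open>
  An affinely independent vertex set is recovered from its convex hull as the set of extreme points.
\<close>

lemma finite_tetrahedra:
  assumes "simplicial_complex K" shows "finite (tetrahedra K)"
proof (rule finite_imageD)
  show "finite ((hull) convex ` tetrahedra K)"
    by (rule finite_subset[of _ K]) (use assms in \<open>auto simp: vertex_sets_def simplicial_complex_def\<close>)
  show "inj_on ((hull) convex) (tetrahedra K)"
  proof (rule inj_onI)
    fix \<sigma> \<tau> assume "\<sigma> \<in> tetrahedra K" "\<tau> \<in> tetrahedra K" and e: "convex hull \<sigma> = convex hull \<tau>"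
    then have "\<not> affine_dependent \<sigma>" "\<not> affine_dependent \<tau>" by (auto simp: vertex_sets_def)
    then show "\<sigma> = \<tau>" using e extreme_point_of_convex_hull_affine_independent by (metis subsetI subset_antisym)
  qed
qed

lemma tetrahedron_labelling:
  assumes "\<tau> \<in> tetrahedra K" "\<epsilon> \<in> edges K" "\<epsilon> \<subseteq> \<tau>"
  obtains i j k h where "\<tau> = {i, j, k, h}" "\<epsilon> = {i, j}" "card {i, j, k, h} = 4"
proof -
  have c: "card \<tau> = 4" "card \<epsilon> = 2" using assms by (auto simp: vertex_sets_def)
  then have "finite \<tau>" using card.infinite by fastforce
  then have "card (\<tau> - \<epsilon>) = 2" using c assms by (simp add: card_Diff_subset finite_subset)
  then obtain i j k h where "\<epsilon> = {i, j}" "\<tau> - \<epsilon> = {k, h}" using c by (meson card_2_iff)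
  moreover from this have "\<tau> = {i, j, k, h}" using assms by auto
  ultimately show ?thesis using that c by metis
qed

definition tetrahedral_at :: "('v set \<Rightarrow> real) \<Rightarrow> 'v \<Rightarrow> 'v \<Rightarrow> 'v \<Rightarrow> 'v \<Rightarrow> bool" where
  "tetrahedral_at d i j k h \<longleftrightarrow>
     tetrahedral (d {i, j}) (d {i, k}) (d {i, h}) (d {j, k}) (d {j, h}) (d {k, h})"

lemma tetrahedral_at_nondegenerate:
  assumes K: "simplicial_complex K" and t: "{i, j, k, h} \<in> tetrahedra K"
    and d: "pl_metric K d" "nondegenerate K d"
  shows "tetrahedral_at d i j k h"
proof -
  have c: "card {i, j, k, h} = 4" using t by (auto simp: vertex_sets_def)
  then have D: "distinct4 i j k h" by (simp add: distinct4_def)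
  obtain P where "realizes P d {i, j, k, h}" using t d by (auto simp: pl_metric_def)
  moreover have "cayley_menger d i j k h \<noteq> 0" using t d(2) unfolding nondegenerate_def by fastforce
  moreover have "d {a, b} > 0" if "a \<in> {i, j, k, h}" "b \<in> {i, j, k, h}" "a \<noteq> b" for a b
    using edge_of_tetrahedron[OF K t that] d by (simp add: pl_metric_def)
  ultimately show ?thesis unfolding tetrahedral_at_def
    using D by (intro tetrahedral_of_realization[OF _ c]) (auto simp: distinct4_iff)
qed

lemma edge_lengths_linear: "bounded_linear (\<lambda>l :: real^'m::finite. edge_lengths e l \<epsilon>)"
  unfolding edge_lengths_def by (rule bounded_linear_vec_nth)

lemmas edge_lengths_has_derivative =
  bounded_linear.has_derivative[OF edge_lengths_linear]

lemmas edge_lengths_tendsto = bounded_linear.tendsto[OF edge_lengths_linear]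

lemma tendsto_tetrahedron_polynomials:
  assumes "(a \<longlongrightarrow> a0) F" "(b \<longlongrightarrow> b0) F" "(c \<longlongrightarrow> c0) F"
    "(p \<longlongrightarrow> p0) F" "(q \<longlongrightarrow> q0) F" "(r \<longlongrightarrow> r0) F"
  shows tendsto_dihedral_num: "((\<lambda>z. dihedral_num (a z) (b z) (c z) (p z) (q z) (r z)) \<longlongrightarrow> dihedral_num a0 b0 c0 p0 q0 r0) F"
    and tendsto_gram_det: "((\<lambda>z. gram_det (a z) (b z) (c z) (p z) (q z) (r z)) \<longlongrightarrow> gram_det a0 b0 c0 p0 q0 r0) F"
    and tendsto_ddihedral_num: "((\<lambda>z. ddihedral_num (a z) (b z) (c z) (p z) (q z) (r z) a' b' c' p' q' r')
     \<longlongrightarrow> ddihedral_num a0 b0 c0 p0 q0 r0 a' b' c' p' q' r') F"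
  unfolding dihedral_num_def gram_det_def ddihedral_num_def by (intro tendsto_intros assms)+

lemma tendsto_heron:
  assumes "(a \<longlongrightarrow> a0) F" "(b \<longlongrightarrow> b0) F" "(p \<longlongrightarrow> p0) F"
  shows "((\<lambda>z. heron (a z) (b z) (p z)) \<longlongrightarrow> heron a0 b0 p0) F"
    and "((\<lambda>z. dheron (a z) (b z) (p z) a' b' p') \<longlongrightarrow> dheron a0 b0 p0 a' b' p') F"
  unfolding heron_def dheron_def by (intro tendsto_intros assms)+

lemma tendsto_dedge_angle:
  assumes T: "tetrahedral a0 b0 c0 p0 q0 r0"
    and lim: "(a \<longlongrightarrow> a0) F" "(b \<longlongrightarrow> b0) F" "(c \<longlongrightarrow> c0) F"
    "(p \<longlongrightarrow> p0) F" "(q \<longlongrightarrow> q0) F" "(r \<longlongrightarrow> r0) F"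
  shows "((\<lambda>z. dedge_angle (a z) (b z) (c z) (p z) (q z) (r z) a' b' c' p' q' r')
     \<longlongrightarrow> dedge_angle a0 b0 c0 p0 q0 r0 a' b' c' p' q' r') F"
  unfolding dedge_angle_def
  by (intro tendsto_divide tendsto_minus tendsto_diff tendsto_mult tendsto_const tendsto_real_sqrt
      tendsto_ddihedral_num tendsto_dihedral_num tendsto_heron tendsto_gram_det lim)
    (use T tetrahedral_faces[OF T] in \<open>auto simp: tetrahedral_def\<close>)

text \<open>
  This openness is what makes the dihedral angle at a nearby length vector meaningful, since a nearby
  vector is only known to be a realizable metric by way of these inequalities.
\<close>

lemma eventually_tetrahedral_at:
  assumes "tetrahedral_at (edge_lengths e l) i j k h"
  shows "\<forall>\<^sub>F l' in nhds l. tetrahedral_at (edge_lengths e l') i j k h"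
proof -
  have E: "((\<lambda>l. edge_lengths e l \<epsilon>) \<longlongrightarrow> edge_lengths e l \<epsilon>) (nhds l)" for \<epsilon>
    by (rule edge_lengths_tendsto[OF filterlim_ident])
  have p: "edge_lengths e l {i, j} > 0" "edge_lengths e l {i, k} > 0" "edge_lengths e l {i, h} > 0"
    "edge_lengths e l {j, k} > 0" "edge_lengths e l {j, h} > 0" "edge_lengths e l {k, h} > 0"
    "heron (edge_lengths e l {i, j}) (edge_lengths e l {i, k}) (edge_lengths e l {j, k}) > 0"
    "gram_det (edge_lengths e l {i, j}) (edge_lengths e l {i, k}) (edge_lengths e l {i, h})
      (edge_lengths e l {j, k}) (edge_lengths e l {j, h}) (edge_lengths e l {k, h}) > 0"
    using assms unfolding tetrahedral_at_def tetrahedral_def by blast+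
  have H: "((\<lambda>l. heron (edge_lengths e l {i, j}) (edge_lengths e l {i, k}) (edge_lengths e l {j, k})) \<longlongrightarrow>
      heron (edge_lengths e l {i, j}) (edge_lengths e l {i, k}) (edge_lengths e l {j, k})) (nhds l)"
    by (intro tendsto_heron E)
  have G: "((\<lambda>l. gram_det (edge_lengths e l {i, j}) (edge_lengths e l {i, k}) (edge_lengths e l {i, h})
      (edge_lengths e l {j, k}) (edge_lengths e l {j, h}) (edge_lengths e l {k, h})) \<longlongrightarrow>
      gram_det (edge_lengths e l {i, j}) (edge_lengths e l {i, k}) (edge_lengths e l {i, h})
      (edge_lengths e l {j, k}) (edge_lengths e l {j, h}) (edge_lengths e l {k, h})) (nhds l)"
    by (intro tendsto_gram_det E)
  note ev = order_tendstoD(1)[OF E p(1)] order_tendstoD(1)[OF E p(2)] order_tendstoD(1)[OF E p(3)]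
      order_tendstoD(1)[OF E p(4)] order_tendstoD(1)[OF E p(5)] order_tendstoD(1)[OF E p(6)]
      order_tendstoD(1)[OF H p(7)] order_tendstoD(1)[OF G p(8)]
  show ?thesis
    unfolding tetrahedral_at_def tetrahedral_def by (intro eventually_conj ev)
qed

lemma dihedral_angle_tetrahedral:
  assumes c: "card {i, j, k, h} = 4" and T: "tetrahedral_at d i j k h"
  shows "dihedral_angle d {i, j} {i, j, k, h} =
    edge_angle (d {i, j}) (d {i, k}) (d {i, h}) (d {j, k}) (d {j, h}) (d {k, h})"
proof -
  obtain P where "realizes P d {i, j, k, h}"
    using realizes_exists[OF c] T unfolding tetrahedral_at_def by blast
  moreover have "d {i, j} > 0" using T by (simp add: tetrahedral_at_def tetrahedral_def)
  ultimately show ?thesis using dihedral_angle_eq[OF _ c] by blast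
qed

definition dedge_angle_at :: "('v set \<Rightarrow> real) \<Rightarrow> ('v set \<Rightarrow> real) \<Rightarrow> 'v \<Rightarrow> 'v \<Rightarrow> 'v \<Rightarrow> 'v \<Rightarrow> real" where
  "dedge_angle_at d v i j k h = dedge_angle (d {i, j}) (d {i, k}) (d {i, h}) (d {j, k}) (d {j, h}) (d {k, h})
     (v {i, j}) (v {i, k}) (v {i, h}) (v {j, k}) (v {j, h}) (v {k, h})"

text \<open>
  By openness the angle agrees near \<open>l\<close> with the explicit function of the six lengths.
\<close>

lemma dihedral_angle_has_derivative:
  assumes c: "card {i, j, k, h} = 4" and T: "tetrahedral_at (edge_lengths e l) i j k h"
  shows "((\<lambda>l. dihedral_angle (edge_lengths e l) {i, j} {i, j, k, h}) has_derivative
     (\<lambda>v. dedge_angle_at (edge_lengths e l) (edge_lengths e v) i j k h)) (at l)"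
proof (rule has_derivative_transform_eventually)
  let ?d = "\<lambda>l. edge_lengths e l"
  have D: "((\<lambda>l. ?d l \<epsilon>) has_derivative (\<lambda>v. ?d v \<epsilon>)) (at l)" for \<epsilon>
    by (rule edge_lengths_has_derivative[OF has_derivative_ident])
  show "((\<lambda>l. edge_angle (?d l {i, j}) (?d l {i, k}) (?d l {i, h}) (?d l {j, k}) (?d l {j, h}) (?d l {k, h}))
     has_derivative (\<lambda>v. dedge_angle_at (edge_lengths e l) (edge_lengths e v) i j k h)) (at l)"
    unfolding dedge_angle_at_def
    using edge_angle_has_derivative[OF D D D D D D] T tetrahedral_faces(1)[OF T[unfolded tetrahedral_at_def]]
    unfolding tetrahedral_at_def tetrahedral_def by blast
  show "\<forall>\<^sub>F l in at l. edge_angle (?d l {i, j}) (?d l {i, k}) (?d l {i, h}) (?d l {j, k}) (?d l {j, h}) (?d l {k, h})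
      = dihedral_angle (edge_lengths e l) {i, j} {i, j, k, h}"
    using eventually_nhds_conv_at[THEN iffD1, OF eventually_tetrahedral_at[OF T]]
    by (auto elim!: eventually_mono simp: dihedral_angle_tetrahedral[OF c])
  show "edge_angle (?d l {i, j}) (?d l {i, k}) (?d l {i, h}) (?d l {j, k}) (?d l {j, h}) (?d l {k, h})
      = dihedral_angle (edge_lengths e l) {i, j} {i, j, k, h}"
    using dihedral_angle_tetrahedral[OF c T] by simp
qed simp

lemma dedge_angle_at_tendsto:
  assumes T: "tetrahedral_at (edge_lengths e l0) i j k h" and l: "(l \<longlongrightarrow> l0) F"
  shows "((\<lambda>t. dedge_angle_at (edge_lengths e (l t)) v i j k h) \<longlongrightarrow> dedge_angle_at (edge_lengths e l0) v i j k h) F"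
  unfolding dedge_angle_at_def
  by (rule tendsto_dedge_angle) (use T in \<open>auto simp: tetrahedral_at_def intro: edge_lengths_tendsto[OF l]\<close>)

lemma dedge_angle_at_euler:
  assumes "tetrahedral_at d i j k h"
  shows "dedge_angle_at d d i j k h = 0"
  using assms dedge_angle_euler by (simp add: dedge_angle_at_def tetrahedral_at_def)

text \<open>
  A Frechet derivative, unlike the explicit formula, does not refer to a labelling of the vertices of
  the tetrahedron, so it can be summed over all tetrahedra at an edge.
\<close>

definition angle_deriv ::
  "('m::finite \<Rightarrow> 'v set) \<Rightarrow> real^'m \<Rightarrow> 'v set \<Rightarrow> 'v set \<Rightarrow> real^'m \<Rightarrow> real" where
  "angle_deriv e l \<epsilon> \<tau> = frechet_derivative (\<lambda>l. dihedral_angle (edge_lengths e l) \<epsilon> \<tau>) (at l)"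

lemma angle_deriv_eq:
  assumes c: "card {i, j, k, h} = 4" and T: "tetrahedral_at (edge_lengths e l) i j k h"
  shows "angle_deriv e l {i, j} {i, j, k, h} = (\<lambda>v. dedge_angle_at (edge_lengths e l) (edge_lengths e v) i j k h)"
  unfolding angle_deriv_def by (rule frechet_derivative_at[symmetric, OF dihedral_angle_has_derivative[OF assms]])

section \<open>Limits of flows and matrices of corank one\<close>

text \<open>
  The mean value theorem on $[t, t+1]$ for the component of \<open>l\<close> along \<open>y\<close>: the increments tend
  to $0$ because \<open>l\<close> converges, and to $|y|^2$ because the velocity does.
\<close>

lemma flow_limit_stationary:
  fixes l :: "real \<Rightarrow> 'a::real_inner"
  assumes d: "\<And>t. t \<ge> 0 \<Longrightarrow> (l has_vector_derivative X t) (at t within {0..})"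
    and l: "(l \<longlongrightarrow> l0) at_top" and X: "(X \<longlongrightarrow> y) at_top"
  shows "y = 0"
proof -
  have "\<exists>s\<ge>t. l (t + 1) \<bullet> y - l t \<bullet> y = X s \<bullet> y" if "t \<ge> 0" for t
  proof -
    have "\<exists>s\<in>{t<..<t + 1}. l (t + 1) \<bullet> y - l t \<bullet> y = (\<lambda>h. (h *\<^sub>R X s) \<bullet> y) (t + 1 - t)"
    proof (rule mvt_simple[where f = "\<lambda>s. l s \<bullet> y" and f' = "\<lambda>s h. (h *\<^sub>R X s) \<bullet> y"])
      fix s assume "t \<le> s" "s \<le> t + 1"
      then have "(l has_vector_derivative X s) (at s within {t..t + 1})"
        using d[of s] that by (auto elim: has_vector_derivative_within_subset)
      then show "((\<lambda>s. l s \<bullet> y) has_derivative (\<lambda>h. (h *\<^sub>R X s) \<bullet> y)) (at s within {t..t + 1})"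
        unfolding has_vector_derivative_def by (rule has_derivative_inner_left)
    qed simp
    then obtain s where "s \<in> {t<..<t + 1}" "l (t + 1) \<bullet> y - l t \<bullet> y = X s \<bullet> y" by auto
    then show ?thesis by (intro exI[of _ s]) auto
  qed
  then obtain s where s: "\<And>t. t \<ge> 0 \<Longrightarrow> s t \<ge> t" "\<And>t. t \<ge> 0 \<Longrightarrow> l (t + 1) \<bullet> y - l t \<bullet> y = X (s t) \<bullet> y"
    by metis
  have "filterlim s at_top at_top"
    by (rule filterlim_at_top_mono[OF filterlim_ident])
      (use eventually_ge_at_top[of 0] in eventually_elim, rule s(1))
  then have "((\<lambda>t. X (s t) \<bullet> y) \<longlongrightarrow> y \<bullet> y) at_top"
    using X by (intro tendsto_intros filterlim_compose[OF X])
  moreover have "\<forall>\<^sub>F t in at_top. X (s t) \<bullet> y = l (t + 1) \<bullet> y - l t \<bullet> y"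
    using eventually_ge_at_top[of 0] by eventually_elim (simp add: s(2))
  ultimately have "((\<lambda>t. l (t + 1) \<bullet> y - l t \<bullet> y) \<longlongrightarrow> y \<bullet> y) at_top"
    using tendsto_cong by fastforce
  moreover have "((\<lambda>t. l (t + 1) \<bullet> y - l t \<bullet> y) \<longlongrightarrow> l0 \<bullet> y - l0 \<bullet> y) at_top"
  proof (intro tendsto_intros l)
    show "((\<lambda>t. l (t + 1)) \<longlongrightarrow> l0) at_top"
      by (rule filterlim_compose[OF l]) (rule filterlim_at_top_mono[OF filterlim_ident], simp)
  qed
  ultimately have "y \<bullet> y = l0 \<bullet> y - l0 \<bullet> y"
    by (rule tendsto_unique[rotated]) simp
  then show ?thesis by simp
qed

text \<open>
  The kernel of a symmetric matrix is orthogonal to its range, which has codimension one; so two vectors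
  of the kernel cannot be independent.
\<close>

lemma symmetric_corank_one_kernel:
  fixes A :: "real^'n^'n"
  assumes sym: "transpose A = A" and rank: "rank A = CARD('n) - 1"
    and x: "A *v x = 0" "x \<noteq> 0" and y: "A *v y = 0"
  shows "\<exists>c. y = c *\<^sub>R x"
proof (rule ccontr)
  assume no: "\<nexists>c. y = c *\<^sub>R x"
  have orth: "u \<bullet> w = 0" if uw: "u \<in> {x, y}" "w \<in> range ((*v) A)" for u w
  proof -
    obtain z where "w = A *v z" using uw(2) by blast
    then have "u \<bullet> w = (A *v u) \<bullet> z" using sym by (metis dot_lmul_matrix transpose_matrix_vector)
    then show ?thesis using uw(1) x y by auto
  qed
  have "y \<notin> span {x}" using no by (auto simp: span_singleton)
  moreover have "independent {x}" using x by (simp add: dependent_single)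
  ultimately have "independent {y, x}" "y \<noteq> x" by (auto simp: independent_insert span_base)
  then have "dim {x, y} = 2" by (simp add: dim_eq_card_independent insert_commute)
  moreover have "dim ({x, y} \<union> range ((*v) A)) = dim {x, y} + dim (range ((*v) A))"
    using orth by (rule dim_orthogonal_sum)
  moreover have "dim ({x, y} \<union> range ((*v) A)) \<le> CARD('n)" by (rule dim_subset_UNIV_cart)
  ultimately show False using rank rank_dim_range[of A] by simp
qed

section \<open>The Jacobian of the curvature\<close>

context
  fixes K :: "'v::euclidean_space set set" and e :: "'m::finite \<Rightarrow> 'v set"
  assumes K: "simplicial_complex K" and e: "bij_betw e UNIV (edges K)"
begin

lemma edge_lengths_indexed [simp]: "edge_lengths e v (e x) = v $ x"
  using e by (simp add: edge_lengths_def bij_betw_def)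

lemma tetrahedral_at_nondeg_metrics:
  assumes "l \<in> nondeg_metrics K e" "{i, j, k, h} \<in> tetrahedra K"
  shows "tetrahedral_at (edge_lengths e l) i j k h"
  using tetrahedral_at_nondegenerate[OF K assms(2)] assms(1) by (auto simp: nondeg_metrics_def)

lemma angle_deriv_labelled:
  assumes "\<tau> \<in> tetrahedra K" "\<epsilon> \<in> edges K" "\<epsilon> \<subseteq> \<tau>"
  obtains i j k h where
    "\<And>l. l \<in> nondeg_metrics K e \<Longrightarrow> tetrahedral_at (edge_lengths e l) i j k h"
    "\<And>l. l \<in> nondeg_metrics K e \<Longrightarrow>
       ((\<lambda>l. dihedral_angle (edge_lengths e l) \<epsilon> \<tau>) has_derivative angle_deriv e l \<epsilon> \<tau>) (at l)"
    "\<And>l. l \<in> nondeg_metrics K e \<Longrightarrow>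
       angle_deriv e l \<epsilon> \<tau> = (\<lambda>v. dedge_angle_at (edge_lengths e l) (edge_lengths e v) i j k h)"
proof -
  obtain i j k h where *: "\<tau> = {i, j, k, h}" "\<epsilon> = {i, j}" "card {i, j, k, h} = 4"
    using tetrahedron_labelling[OF assms] .
  note T = tetrahedral_at_nondeg_metrics[OF _ assms(1)[unfolded *(1)]]
  show ?thesis
  proof (rule that)
    fix l assume l: "l \<in> nondeg_metrics K e"
    show "tetrahedral_at (edge_lengths e l) i j k h" using T[OF l] .
    show eq: "angle_deriv e l \<epsilon> \<tau> = (\<lambda>v. dedge_angle_at (edge_lengths e l) (edge_lengths e v) i j k h)"
      unfolding *(1,2) by (rule angle_deriv_eq[OF *(3) T[OF l]])
    show "((\<lambda>l. dihedral_angle (edge_lengths e l) \<epsilon> \<tau>) has_derivative angle_deriv e l \<epsilon> \<tau>) (at l)"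
      unfolding eq unfolding *(1,2) by (rule dihedral_angle_has_derivative[OF *(3) T[OF l]])
  qed
qed

lemma angle_deriv_facts:
  assumes "\<tau> \<in> tetrahedra K" "\<epsilon> \<in> edges K" "\<epsilon> \<subseteq> \<tau>" and l: "l \<in> nondeg_metrics K e"
  shows dihedral_angle_deriv:
      "((\<lambda>l. dihedral_angle (edge_lengths e l) \<epsilon> \<tau>) has_derivative angle_deriv e l \<epsilon> \<tau>) (at l)"
    and angle_deriv_euler: "angle_deriv e l \<epsilon> \<tau> l = 0"
    and angle_deriv_tendsto: "\<And>g F v. (g \<longlongrightarrow> l) F \<Longrightarrow> \<forall>\<^sub>F t in F. g t \<in> nondeg_metrics K e \<Longrightarrow>
       ((\<lambda>t. angle_deriv e (g t) \<epsilon> \<tau> v) \<longlongrightarrow> angle_deriv e l \<epsilon> \<tau> v) F"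
proof -
  obtain i j k h where
    T: "\<And>l. l \<in> nondeg_metrics K e \<Longrightarrow> tetrahedral_at (edge_lengths e l) i j k h"
    and D: "\<And>l. l \<in> nondeg_metrics K e \<Longrightarrow>
       ((\<lambda>l. dihedral_angle (edge_lengths e l) \<epsilon> \<tau>) has_derivative angle_deriv e l \<epsilon> \<tau>) (at l)"
    and eq: "\<And>l. l \<in> nondeg_metrics K e \<Longrightarrow>
       angle_deriv e l \<epsilon> \<tau> = (\<lambda>v. dedge_angle_at (edge_lengths e l) (edge_lengths e v) i j k h)"
    by (rule angle_deriv_labelled[OF assms(1-3)]) blast
  show "((\<lambda>l. dihedral_angle (edge_lengths e l) \<epsilon> \<tau>) has_derivative angle_deriv e l \<epsilon> \<tau>) (at l)"
    by (rule D[OF l])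
  show "angle_deriv e l \<epsilon> \<tau> l = 0" unfolding eq[OF l] by (rule dedge_angle_at_euler[OF T[OF l]])
  fix g :: "'b \<Rightarrow> real^'m" and F v
  assume lim: "(g \<longlongrightarrow> l) F" and ev: "\<forall>\<^sub>F t in F. g t \<in> nondeg_metrics K e"
  have "((\<lambda>t. dedge_angle_at (edge_lengths e (g t)) (edge_lengths e v) i j k h)
      \<longlongrightarrow> dedge_angle_at (edge_lengths e l) (edge_lengths e v) i j k h) F"
    by (rule dedge_angle_at_tendsto[OF T[OF l] lim])
  then show "((\<lambda>t. angle_deriv e (g t) \<epsilon> \<tau> v) \<longlongrightarrow> angle_deriv e l \<epsilon> \<tau> v) F"
    unfolding eq[OF l] by (rule Lim_transform_eventually) (use ev in eventually_elim, simp add: eq)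
qed

lemma indexed_edge: "e x \<in> edges K"
  using e by (auto simp: bij_betw_def)

lemma curvature_vec_has_derivative:
  assumes l: "l \<in> nondeg_metrics K e"
  shows "((\<lambda>l. curvature_vec K e l $ x) has_derivative
     (\<lambda>v. - (\<Sum>\<tau> | \<tau> \<in> tetrahedra K \<and> e x \<subseteq> \<tau>. angle_deriv e l (e x) \<tau> v))) (at l)"
proof -
  have "((\<lambda>l. \<Sum>\<tau> | \<tau> \<in> tetrahedra K \<and> e x \<subseteq> \<tau>. dihedral_angle (edge_lengths e l) (e x) \<tau>) has_derivative
     (\<lambda>v. \<Sum>\<tau> | \<tau> \<in> tetrahedra K \<and> e x \<subseteq> \<tau>. angle_deriv e l (e x) \<tau> v)) (at l)"
    by (rule has_derivative_sum) (use dihedral_angle_deriv indexed_edge l in auto)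
  from has_derivative_diff[OF has_derivative_const this, of "2 * pi"]
  show ?thesis by (simp add: curvature_vec_def curvature_def)
qed

lemma curvature_jacobian_eq:
  assumes l: "l \<in> nondeg_metrics K e"
  shows "curvature_jacobian K e l $ x $ y =
    - (\<Sum>\<tau> | \<tau> \<in> tetrahedra K \<and> e x \<subseteq> \<tau>. angle_deriv e l (e x) \<tau> (axis y 1))" (is "_ = ?D (axis y 1)")
proof -
  have D: "((\<lambda>l. curvature_vec K e l $ x) has_derivative ?D) (at l)"
    by (rule curvature_vec_has_derivative[OF l])
  have "((\<lambda>s. l + s *\<^sub>R axis y 1) has_derivative (\<lambda>s. s *\<^sub>R axis y 1)) (at (0::real))"
    by (auto intro!: derivative_eq_intros)
  from has_derivative_compose[OF this, of "\<lambda>l. curvature_vec K e l $ x" ?D] D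
  have "((\<lambda>s. curvature_vec K e (l + s *\<^sub>R axis y 1) $ x) has_derivative (\<lambda>s. ?D (s *\<^sub>R axis y 1))) (at 0)"
    by simp
  moreover have "?D (s *\<^sub>R axis y 1) = ?D (axis y 1) * s" for s
    using linear_cmul[OF has_derivative_linear[OF D], of s "axis y 1"] by simp
  ultimately have "((\<lambda>s. curvature_vec K e (l + s *\<^sub>R axis y 1) $ x) has_field_derivative ?D (axis y 1)) (at 0)"
    unfolding has_field_derivative_def by (simp only:)
  then show ?thesis by (simp add: curvature_jacobian_def DERIV_imp_deriv)
qed

text \<open>
  The Jacobian is defined by partial derivatives; this identifies the matrix with the total derivative.
\<close>

lemma curvature_jacobian_mult:
  assumes l: "l \<in> nondeg_metrics K e"
  shows "(curvature_jacobian K e l *v v) $ x =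
    - (\<Sum>\<tau> | \<tau> \<in> tetrahedra K \<and> e x \<subseteq> \<tau>. angle_deriv e l (e x) \<tau> v)" (is "_ = ?D v")
proof -
  have lin: "linear ?D" by (rule has_derivative_linear[OF curvature_vec_has_derivative[OF l]])
  have "?D v = ?D (\<Sum>y\<in>UNIV. v $ y *\<^sub>R axis y 1)"
    using basis_expansion[of v] by (simp add: scalar_mult_eq_scaleR)
  also have "\<dots> = (\<Sum>y\<in>UNIV. v $ y * ?D (axis y 1))"
    unfolding linear_sum[OF lin] linear_cmul[OF lin] by simp
  finally show ?thesis
    by (simp add: matrix_vector_mult_def curvature_jacobian_eq[OF l] mult.commute)
qed

lemma curvature_jacobian_scaling:
  assumes l: "l \<in> nondeg_metrics K e"
  shows "curvature_jacobian K e l *v l = 0"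
  unfolding vec_eq_iff curvature_jacobian_mult[OF l]
  using angle_deriv_euler[OF _ indexed_edge _ l] by simp

text \<open>
  With the vertices labelled, both sides are the form \<open>schlaefli_form\<close> with its two arguments
  exchanged.
\<close>

lemma tetrahedron_form_symmetric:
  assumes t: "\<tau> \<in> tetrahedra K" and l: "l \<in> nondeg_metrics K e"
  shows "(\<Sum>\<epsilon> | \<epsilon> \<in> edges K \<and> \<epsilon> \<subseteq> \<tau>. edge_lengths e v \<epsilon> * angle_deriv e l \<epsilon> \<tau> w)
    = (\<Sum>\<epsilon> | \<epsilon> \<in> edges K \<and> \<epsilon> \<subseteq> \<tau>. edge_lengths e w \<epsilon> * angle_deriv e l \<epsilon> \<tau> v)"
proof -
  have "card \<tau> = 4" using t by (simp add: vertex_sets_def)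
  then obtain i j k h where \<tau>: "\<tau> = {i, j, k, h}" and D: "i \<noteq> j" "i \<noteq> k" "i \<noteq> h" "j \<noteq> k" "j \<noteq> h" "k \<noteq> h"
    by (auto simp: card_Suc_eq numeral_eq_Suc)
  have "{\<epsilon>. \<epsilon> \<in> edges K \<and> \<epsilon> \<subseteq> \<tau>} = {{i, j}, {i, k}, {i, h}, {j, k}, {j, h}, {k, h}}" (is "?L = ?R")
  proof
    show "?L \<subseteq> ?R"
    proof
      fix \<epsilon> assume "\<epsilon> \<in> ?L"
      then have "card \<epsilon> = 2" "\<epsilon> \<subseteq> {i, j, k, h}" by (auto simp: vertex_sets_def \<tau>)
      then obtain a b where "\<epsilon> = {a, b}" "a \<noteq> b" "a \<in> {i, j, k, h}" "b \<in> {i, j, k, h}" by (auto simp: card_2_iff)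
      then show "\<epsilon> \<in> ?R" by (auto simp: insert_commute)
    qed
    show "?R \<subseteq> ?L" using D by (auto intro!: edge_of_tetrahedron[OF K t] simp: \<tau> simp del: One_nat_def)
  qed
  moreover have "(\<Sum>\<epsilon>\<in>?R. f \<epsilon>) = f {i, j} + f {i, k} + f {i, h} + f {j, k} + f {j, h} + f {k, h}"
    for f :: "'v set \<Rightarrow> real"
    using D by (simp add: doubleton_eq_iff add.assoc)
  moreover have ang: "angle_deriv e l {a, b} \<tau> u = dedge_angle_at (edge_lengths e l) (edge_lengths e u) a b m n"
    if "{a, b, m, n} = {i, j, k, h}" for a b m n u
  proof -
    have *: "{a, b, m, n} = \<tau>" using that \<tau> by simp
    have "card {a, b, m, n} = 4" using * t by (simp add: vertex_sets_def)
    from angle_deriv_eq[OF this tetrahedral_at_nondeg_metrics[OF l]] t *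
    show ?thesis by metis
  qed
  have "angle_deriv e l {i, j} \<tau> u = dedge_angle_at (edge_lengths e l) (edge_lengths e u) i j k h"
    "angle_deriv e l {i, k} \<tau> u = dedge_angle_at (edge_lengths e l) (edge_lengths e u) i k j h"
    "angle_deriv e l {i, h} \<tau> u = dedge_angle_at (edge_lengths e l) (edge_lengths e u) i h j k"
    "angle_deriv e l {j, k} \<tau> u = dedge_angle_at (edge_lengths e l) (edge_lengths e u) j k i h"
    "angle_deriv e l {j, h} \<tau> u = dedge_angle_at (edge_lengths e l) (edge_lengths e u) j h i k"
    "angle_deriv e l {k, h} \<tau> u = dedge_angle_at (edge_lengths e l) (edge_lengths e u) k h i j" for u
    by (rule ang, auto)+
  moreover have "{k, i} = {i, k}" "{j, i} = {i, j}" "{h, i} = {i, h}" "{k, j} = {j, k}" "{h, j} = {j, h}" "{h, k} = {k, h}"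
    by auto
  moreover have "tetrahedral (edge_lengths e l {i, j}) (edge_lengths e l {i, k}) (edge_lengths e l {i, h})
    (edge_lengths e l {j, k}) (edge_lengths e l {j, h}) (edge_lengths e l {k, h})"
    using tetrahedral_at_nondeg_metrics[OF l t[unfolded \<tau>]] by (simp add: tetrahedral_at_def)
  moreover note schlaefli_form_sym[OF this, where va = "edge_lengths e v {i, j}" and vb = "edge_lengths e v {i, k}"
      and vc = "edge_lengths e v {i, h}" and vp = "edge_lengths e v {j, k}" and vq = "edge_lengths e v {j, h}"
      and vr = "edge_lengths e v {k, h}" and ha = "edge_lengths e w {i, j}" and hb = "edge_lengths e w {i, k}"
      and hc = "edge_lengths e w {i, h}" and hp = "edge_lengths e w {j, k}" and hq = "edge_lengths e w {j, h}"
      and hr = "edge_lengths e w {k, h}"]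
  ultimately show ?thesis
    unfolding schlaefli_form_def dedge_angle_at_def by (simp only:)
qed

text \<open>
  Exchanging the summations over edges and tetrahedra turns the bilinear form of the Jacobian into a sum
  of the symmetric forms of the tetrahedra.
\<close>

lemma curvature_jacobian_symmetric:
  assumes l: "l \<in> nondeg_metrics K e"
  shows "transpose (curvature_jacobian K e l) = curvature_jacobian K e l"
proof -
  have form: "v \<bullet> (curvature_jacobian K e l *v w) =
    - (\<Sum>\<tau>\<in>tetrahedra K. \<Sum>\<epsilon> | \<epsilon> \<in> edges K \<and> \<epsilon> \<subseteq> \<tau>. edge_lengths e v \<epsilon> * angle_deriv e l \<epsilon> \<tau> w)"
    for v w
  proof -
    have "v \<bullet> (curvature_jacobian K e l *v w) =
      - (\<Sum>x\<in>UNIV. \<Sum>\<tau> | \<tau> \<in> tetrahedra K \<and> e x \<subseteq> \<tau>. edge_lengths e v (e x) * angle_deriv e l (e x) \<tau> w)"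
      by (simp add: inner_vec_def curvature_jacobian_mult[OF l] sum_distrib_left sum_negf)
    also have "\<dots> = - (\<Sum>\<epsilon>\<in>edges K. \<Sum>\<tau> | \<tau> \<in> tetrahedra K \<and> \<epsilon> \<subseteq> \<tau>. edge_lengths e v \<epsilon> * angle_deriv e l \<epsilon> \<tau> w)"
      by (subst sum.reindex_bij_betw[OF e]) simp
    also have "\<dots> = - (\<Sum>\<tau>\<in>tetrahedra K. \<Sum>\<epsilon> | \<epsilon> \<in> edges K \<and> \<epsilon> \<subseteq> \<tau>. edge_lengths e v \<epsilon> * angle_deriv e l \<epsilon> \<tau> w)"
      using bij_betw_finite[OF e] by (subst sum.swap_restrict) (simp_all add: finite_tetrahedra[OF K])
    finally show ?thesis .
  qed
  have "v \<bullet> (curvature_jacobian K e l *v w) = w \<bullet> (curvature_jacobian K e l *v v)" for v w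
    unfolding form using tetrahedron_form_symmetric[OF _ l] by simp
  from this[of "axis x 1" "axis y 1" for x y] show ?thesis
    by (simp add: vec_eq_iff transpose_def inner_axis' matrix_vector_mult_basis column_def)
qed

lemma curvature_field_tendsto:
  assumes l0: "l0 \<in> nondeg_metrics K e" and l: "(l \<longlongrightarrow> l0) F"
    and ev: "\<forall>\<^sub>F t in F. l t \<in> nondeg_metrics K e"
  shows "((\<lambda>t. transpose (curvature_jacobian K e (l t)) *v curvature_vec K e (l t)) \<longlongrightarrow>
    transpose (curvature_jacobian K e l0) *v curvature_vec K e l0) F"
proof (rule vec_tendstoI)
  fix y
  have R: "((\<lambda>t. curvature_vec K e (l t) $ x) \<longlongrightarrow> curvature_vec K e l0 $ x) F" for x
    by (rule isCont_tendsto_compose[OF has_derivative_continuous[OF curvature_vec_has_derivative[OF l0]] l])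
  have "((\<lambda>t. - (\<Sum>\<tau> | \<tau> \<in> tetrahedra K \<and> e x \<subseteq> \<tau>. angle_deriv e (l t) (e x) \<tau> (axis y 1)))
     \<longlongrightarrow> curvature_jacobian K e l0 $ x $ y) F" for x
    unfolding curvature_jacobian_eq[OF l0]
    by (intro tendsto_intros angle_deriv_tendsto[OF _ indexed_edge _ l0 l ev]) auto
  then have J: "((\<lambda>t. curvature_jacobian K e (l t) $ x $ y) \<longlongrightarrow> curvature_jacobian K e l0 $ x $ y) F" for x
    by (rule Lim_transform_eventually) (use ev in eventually_elim, simp add: curvature_jacobian_eq)
  show "((\<lambda>t. (transpose (curvature_jacobian K e (l t)) *v curvature_vec K e (l t)) $ y) \<longlongrightarrow>
    (transpose (curvature_jacobian K e l0) *v curvature_vec K e l0) $ y) F"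
    unfolding matrix_vector_mult_def transpose_def by (simp, intro tendsto_intros J R)
qed

end

section \<open>Convergence of the flow to an Einstein metric\<close>

theorem theorem3p1:
  fixes M :: "'x topology"
    and K :: "'v::euclidean_space set set"
    and e :: "'m::finite \<Rightarrow> 'v set"
    and l :: "real \<Rightarrow> real^'m"
    and l_inf :: "real^'m"
  assumes "compact_3_manifold M"
    and "triangulates K M"
    and "bij_betw e UNIV (edges K)"
    and "\<And>t. t \<ge> 0 \<Longrightarrow> l t \<in> nondeg_metrics K e"
    and "\<And>t. t \<ge> 0 \<Longrightarrow>
           (l has_vector_derivative
              - (transpose (curvature_jacobian K e (l t)) *v curvature_vec K e (l t)))
             (at t within {0..})"
    and "(l \<longlongrightarrow> l_inf) at_top"
    and "l_inf \<in> max_rank_metrics K e"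
  shows "(\<exists>g. discrete_einstein K e g) \<and> discrete_einstein K e l_inf"
proof -
  have K: "simplicial_complex K" using assms(2) by (simp add: triangulates_def)
  note e = assms(3)
  have l: "l_inf \<in> nondeg_metrics K e" and rank: "rank (curvature_jacobian K e l_inf) = CARD('m) - 1"
    using assms(7) by (auto simp: max_rank_metrics_def)
  note sym = curvature_jacobian_symmetric[OF K e l]
  have "\<forall>\<^sub>F t in at_top. l t \<in> nondeg_metrics K e"
    using eventually_ge_at_top[of 0] by eventually_elim (rule assms(4))
  note X = tendsto_minus[OF curvature_field_tendsto[OF K e l assms(6) this]]
  have "- (transpose (curvature_jacobian K e l_inf) *v curvature_vec K e l_inf) = 0"
    by (rule flow_limit_stationary[OF _ assms(6) X]) (rule assms(5))
  then have R: "curvature_jacobian K e l_inf *v curvature_vec K e l_inf = 0" by (simp add: sym)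
  have "l_inf $ x > 0" for x
    using l indexed_edge[OF K e] edge_lengths_indexed[OF K e] by (force simp: nondeg_metrics_def pl_metric_def)
  then have "l_inf \<noteq> 0" by (metis less_irrefl zero_index)
  from symmetric_corank_one_kernel[OF sym rank curvature_jacobian_scaling[OF K e l] this R]
  have "discrete_einstein K e l_inf" using l by (simp add: discrete_einstein_def)
  then show ?thesis by blast
qed

end
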